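(* Let $X$ be a complex Banach space with a Schauder basis $(e_i)_{i\in\mathbb{N}}$, let $G$ be a group of $\mathcal{L}(X)$ that acts separately continuously on $X$, and let $K$ be a $G$-invariant set in $X$. Suppose there exists a subsequence $(j_n)\subset\mathbb{N}$ such that \begin{enumerate} \item $\Sigma_{j_n}(G)$ is a compact subgroup (of $\mathcal{L}(\mathbb{C}^{j_n})$) for each $n\in\mathbb{N}$, \item $g(\mathrm{span}\{e_i: i\geq j_n+1\})\subset\mathrm{span}\{e_i: i\geq j_n+1\}$ for every $n\in\mathbb{N}$ and $g\in G$, \item $\pi_{j_n}(K)\subset K$ for every $n\in\mathbb{N}$. \end{enumerate} Suppose further that an element $z\in X\setminus K$ can be separated from $K$ by a continuous polynomial $Q$ which satisfies that, for some $r\in(0,1)$, the set $$\{\mathrm{Arg}\left((Q\circ\iota_{j_n})(\gamma(\Pi_{j_n}(z)))\right)\in[0,2\pi): |(Q\circ\iota_{j_n})(\gamma(\Pi_{j_n}(z)))|\geq r,\ \gamma\in\Sigma_{j_n}(G)\}$$ is finite for each $n\in\mathbb{N}$. Then there exists a $G$-invariant continuous polynomial $P$ that separates $z$ and $K$. Furthermore, if $Q$ is homogeneous, then $P$ can be chosen to be homogeneous.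
   Context: $\mathcal{L}(X)$ is the space of continuous linear maps from $X$ into itself. A group of $\mathcal{L}(X)$ is a subset $G\subset\mathcal{L}(X)$ that is a group under composition (with identity $Id_X$), endowed with a topology making it a topological group; it acts on $X$ by $(\gamma,x)\mapsto\gamma(x)$, and the action is separately continuous if this map $G\times X\to X$ is separately continuous. A set $K\subset X$ is $G$-invariant if $\gamma(K)\subset K$ for every $\gamma\in G$. For $z=\sum_{j=1}^\infty z_je_j\in X$ put $\pi_n(z)=\sum_{j=1}^n z_je_j\in X$ and $\Pi_n(z)=(z_1,\ldots,z_n)\in\mathbb{C}^n$; let $\iota_n:\mathbb{C}^n\to X$, $\iota_n(z_1,\ldots,z_n)=\sum_{j=1}^n z_je_j$. Define $\Sigma_n(G)=\{\Pi_n\circ g\circ\iota_n: g\in G\}\subset\mathcal{L}(\mathbb{C}^n)$ (in general not a group); $\mathcal{L}(\mathbb{C}^n)$ has its usual topology. A subsequence $(j_n)\subset\mathbb{N}$ is a strictly increasing sequence of natural numbers. Polynomials are complex-valued; a polynomial $P$ on $X$ is $G$-invariant if $P(\gamma(x))=P(x)$ for all $x\in X$, $\gamma\in G$. A polynomial $P$ separates a point $z$ and a set $K$ if $\sup_{w\in K}|P(w)|<|P(z)|$. $\mathrm{Arg}(w)\in[0,2\pi)$ denotes the argument of a complex number $w\neq0$.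
   Formalization: The condition r < |Q(z)| is added: without it, scaling Q makes the set of arguments empty and the claim fails (circle acting on the first coordinate of l^2, K the unit disc in Ce_1, z = 2e_1, Q = x_1/8, r = 1/2). *)

theory Defs
  imports "HOL-Analysis.Analysis" "HOL-Algebra.Group"
begin

section \<open>Complex Banach spaces and Schauder bases\<close>

class scaleC =
  fixes scaleC :: "complex \<Rightarrow> 'a \<Rightarrow> 'a" (infixr \<open>*\<^sub>C\<close> 75)

class complex_banach = banach + scaleC +
  assumes scaleC_add_right: "c *\<^sub>C (x + y) = c *\<^sub>C x + c *\<^sub>C y"
    and scaleC_add_left: "(b + c) *\<^sub>C x = b *\<^sub>C x + c *\<^sub>C x"
    and scaleC_scaleC: "b *\<^sub>C (c *\<^sub>C x) = (b * c) *\<^sub>C x"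
    and scaleC_one: "1 *\<^sub>C x = x"
    and scaleR_scaleC: "r *\<^sub>R x = complex_of_real r *\<^sub>C x"
    and norm_scaleC: "norm (c *\<^sub>C x) = cmod c * norm x"

lemma vector_space_scaleC: "vector_space ((*\<^sub>C) :: complex \<Rightarrow> 'a \<Rightarrow> 'a::complex_banach)"
  by unfold_locales (simp_all add: scaleC_add_right scaleC_add_left scaleC_scaleC scaleC_one)

text \<open>Basis vectors are numbered from 0: the informal \<open>e\<^sub>1, e\<^sub>2, \<dots>\<close> are \<open>e 0, e 1, \<dots>\<close>
  here, so that the first \<open>n\<close> of them are the \<open>e i\<close> with \<open>i < n\<close>.\<close>

definition schauder_basis :: "(nat \<Rightarrow> 'a::complex_banach) \<Rightarrow> bool" where
  "schauder_basis e \<longleftrightarrow> (\<forall>x. \<exists>!c. (\<lambda>i. c i *\<^sub>C e i) sums x)"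

definition coords :: "(nat \<Rightarrow> 'a::complex_banach) \<Rightarrow> 'a \<Rightarrow> nat \<Rightarrow> complex" where
  "coords e x = (THE c. (\<lambda>i. c i *\<^sub>C e i) sums x)"

definition basis_proj :: "(nat \<Rightarrow> 'a::complex_banach) \<Rightarrow> nat \<Rightarrow> 'a \<Rightarrow> 'a" where
  "basis_proj e n x = (\<Sum>i<n. coords e x i *\<^sub>C e i)"


section \<open>Complex n-space and its linear maps\<close>

text \<open>A vector of complex \<open>n\<close>-space is a sequence vanishing from index \<open>n\<close> on.  A linear map
  of this space into itself is represented by its unique extension to all sequences
  that depends on the first \<open>n\<close> entries only; thus composition of maps is \<open>(\<circ>)\<close>, and the
  identity map is represented by the truncation \<open>Cn_id n\<close>.\<close>

definition Cn :: "nat \<Rightarrow> (nat \<Rightarrow> complex) set" where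
  "Cn n = {v. \<forall>i\<ge>n. v i = 0}"

definition Cn_norm :: "nat \<Rightarrow> (nat \<Rightarrow> complex) \<Rightarrow> real" where
  "Cn_norm n v = L2_set (\<lambda>i. cmod (v i)) {..<n}"

definition Cn_id :: "nat \<Rightarrow> (nat \<Rightarrow> complex) \<Rightarrow> (nat \<Rightarrow> complex)" where
  "Cn_id n v = (\<lambda>i. if i < n then v i else 0)"

definition LCn :: "nat \<Rightarrow> ((nat \<Rightarrow> complex) \<Rightarrow> (nat \<Rightarrow> complex)) set" where
  "LCn n = {T. (\<forall>v. T v \<in> Cn n) \<and> (\<forall>v. T (Cn_id n v) = T v) \<and>
     (\<forall>u v. T (\<lambda>i. u i + v i) = (\<lambda>i. T u i + T v i)) \<and>
     (\<forall>c v. T (\<lambda>i. c * v i) = (\<lambda>i. c * T v i))}"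

definition LCn_dist ::
  "nat \<Rightarrow> ((nat \<Rightarrow> complex) \<Rightarrow> (nat \<Rightarrow> complex)) \<Rightarrow> ((nat \<Rightarrow> complex) \<Rightarrow> (nat \<Rightarrow> complex)) \<Rightarrow> real"
where \<comment> \<open>operator norm of the difference; the value outside \<open>LCn n\<close> is irrelevant\<close>
  "LCn_dist n S T =
     (if S \<in> LCn n \<and> T \<in> LCn n
      then (SUP v\<in>{v \<in> Cn n. Cn_norm n v \<le> 1}. Cn_norm n (\<lambda>i. S v i - T v i)) else 0)"

lemma LCn_expand:
  assumes T: "T \<in> LCn n"
  shows "T v i = (\<Sum>k<n. v k * T (\<lambda>l. if l = k then 1 else 0) i)"
proof -
  have add: "T (\<lambda>i. u i + w i) i = T u i + T w i"
    and scale: "T (\<lambda>i. c * u i) i = c * T u i" for u w c i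
    using T by (auto simp: LCn_def)
  have "T (Cn_id m v) i = (\<Sum>k<m. v k * T (\<lambda>l. if l = k then 1 else 0) i)" for m
  proof (induction m)
    case 0
    have "Cn_id 0 v = (\<lambda>i. 0 * v i)" by (simp add: Cn_id_def)
    then show ?case using scale[of 0 v i] by simp
  next
    case (Suc m)
    have "Cn_id (Suc m) v = (\<lambda>i. Cn_id m v i + v m * (if i = m then 1 else 0))"
      by (auto simp: Cn_id_def fun_eq_iff less_Suc_eq)
    then show ?case using Suc by (simp only: add scale sum.lessThan_Suc)
  qed
  moreover have "T (Cn_id n v) = T v" using T by (auto simp: LCn_def)
  ultimately show ?thesis by metis
qed

lemma LCn_diff:
  assumes "S \<in> LCn n" "T \<in> LCn n"
  shows "(\<lambda>v i. S v i - T v i) \<in> LCn n"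
  using assms by (auto simp: LCn_def Cn_def algebra_simps)

lemma LCn_bdd:
  assumes T: "T \<in> LCn n"
  shows "bdd_above ((\<lambda>v. Cn_norm n (T v)) ` {v \<in> Cn n. Cn_norm n v \<le> 1})"
proof (rule bdd_aboveI2)
  fix v assume v: "v \<in> {v \<in> Cn n. Cn_norm n v \<le> 1}"
  have v1: "cmod (v k) \<le> 1" if "k < n" for k
    using v member_le_L2_set[of "{..<n}" k "\<lambda>i. cmod (v i)"] that
    by (simp add: Cn_norm_def)
  have "Cn_norm n (T v) \<le> (\<Sum>i<n. cmod (T v i))"
    unfolding Cn_norm_def by (rule L2_set_le_sum) simp
  also have "\<dots> \<le> (\<Sum>i<n. \<Sum>k<n. cmod (T (\<lambda>l. if l = k then 1 else 0) i))"
  proof (rule sum_mono)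
    fix i
    have "cmod (T v i) \<le> (\<Sum>k<n. cmod (v k * T (\<lambda>l. if l = k then 1 else 0) i))"
      unfolding LCn_expand[OF T, of v i] by (rule norm_sum)
    also have "\<dots> \<le> (\<Sum>k<n. cmod (T (\<lambda>l. if l = k then 1 else 0) i))"
      by (rule sum_mono) (auto simp: norm_mult intro!: mult_left_le_one_le v1)
    finally show "cmod (T v i) \<le> (\<Sum>k<n. cmod (T (\<lambda>l. if l = k then 1 else 0) i))" .
  qed
  finally show "Cn_norm n (T v) \<le> (\<Sum>i<n. \<Sum>k<n. cmod (T (\<lambda>l. if l = k then 1 else 0) i))" .
qed

lemma LCn_dist_upper:
  assumes "S \<in> LCn n" "T \<in> LCn n" "v \<in> Cn n" "Cn_norm n v \<le> 1"
  shows "Cn_norm n (\<lambda>i. S v i - T v i) \<le> LCn_dist n S T"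
proof -
  have "Cn_norm n (\<lambda>i. S v i - T v i)
      \<le> (SUP v\<in>{v \<in> Cn n. Cn_norm n v \<le> 1}. Cn_norm n (\<lambda>i. S v i - T v i))"
    by (rule cSUP_upper) (use assms LCn_bdd[OF LCn_diff[OF assms(1,2)]] in auto)
  then show ?thesis using assms by (simp add: LCn_dist_def)
qed

lemma zero_mem_Cn_ball: "(\<lambda>_. 0) \<in> {v \<in> Cn n. Cn_norm n v \<le> 1}"
  by (simp add: Cn_def Cn_norm_def L2_set_def)

lemma LCn_dist_least:
  assumes "S \<in> LCn n" "T \<in> LCn n"
    and "\<And>v. v \<in> Cn n \<Longrightarrow> Cn_norm n v \<le> 1 \<Longrightarrow> Cn_norm n (\<lambda>i. S v i - T v i) \<le> b"
  shows "LCn_dist n S T \<le> b"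
proof -
  have "(SUP v\<in>{v \<in> Cn n. Cn_norm n v \<le> 1}. Cn_norm n (\<lambda>i. S v i - T v i)) \<le> b"
    by (rule cSUP_least) (use assms(3) zero_mem_Cn_ball in blast)+
  then show ?thesis using assms by (simp add: LCn_dist_def)
qed

lemma LCn_dist_nonneg: "0 \<le> LCn_dist n S T"
proof (cases "S \<in> LCn n \<and> T \<in> LCn n")
  case True
  then show ?thesis
    using LCn_dist_upper[of S n T "\<lambda>_. 0"] zero_mem_Cn_ball[of n]
    by (force simp: Cn_norm_def intro: order_trans[OF L2_set_nonneg])
qed (auto simp: LCn_dist_def)

lemma LCn_Metric_space: "Metric_space (LCn n) (LCn_dist n)"
proof
  fix S T :: "(nat \<Rightarrow> complex) \<Rightarrow> (nat \<Rightarrow> complex)"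
  show "0 \<le> LCn_dist n S T" by (rule LCn_dist_nonneg)
  have sym: "Cn_norm n (\<lambda>i. S v i - T v i) = Cn_norm n (\<lambda>i. T v i - S v i)" for v
    by (simp add: Cn_norm_def norm_minus_commute)
  show "LCn_dist n S T = LCn_dist n T S"
    by (simp add: LCn_dist_def sym conj_commute)
next
  fix S T assume S: "S \<in> LCn n" and T: "T \<in> LCn n"
  show "LCn_dist n S T = 0 \<longleftrightarrow> S = T"
  proof
    assume "S = T"
    then have "LCn_dist n S T \<le> 0"
      by (intro LCn_dist_least S T) (simp add: Cn_norm_def L2_set_def)
    then show "LCn_dist n S T = 0" using LCn_dist_nonneg[of n S T] by linarith
  next
    assume d0: "LCn_dist n S T = 0"
    have unit: "S (\<lambda>l. if l = k then 1 else 0) i = T (\<lambda>l. if l = k then 1 else 0) i"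
      if "k < n" "i < n" for k i
    proof -
      let ?u = "\<lambda>l. if l = k then 1 else 0 :: complex"
      have "Cn_norm n ?u \<le> (\<Sum>i<n. cmod (?u i))"
        unfolding Cn_norm_def by (rule L2_set_le_sum) simp
      also have "\<dots> = (\<Sum>i<n. if i = k then 1 else 0)"
        by (rule sum.cong) auto
      also have "\<dots> = 1" using that by simp
      finally have "Cn_norm n (\<lambda>i. S ?u i - T ?u i) \<le> 0"
        using LCn_dist_upper[OF S T, of ?u] that d0 by (auto simp: Cn_def)
      moreover have "cmod (S ?u i - T ?u i) \<le> Cn_norm n (\<lambda>i. S ?u i - T ?u i)"
        unfolding Cn_norm_def
        by (rule member_le_L2_set[of "{..<n}" i "\<lambda>i. cmod (S ?u i - T ?u i)"]) (use that in auto)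
      ultimately have "cmod (S ?u i - T ?u i) \<le> 0" by (rule order_trans[rotated])
      then show ?thesis by (simp only: norm_le_zero_iff right_minus_eq)
    qed
    have "S v i = T v i" for v i
    proof (cases "i < n")
      case True
      then show ?thesis unfolding LCn_expand[OF S, of v i] LCn_expand[OF T, of v i]
        by (intro sum.cong) (auto simp: unit)
    next
      case False
      then show ?thesis using S T by (auto simp: LCn_def Cn_def)
    qed
    then show "S = T" by blast
  qed
next
  fix S T U assume S: "S \<in> LCn n" and T: "T \<in> LCn n" and U: "U \<in> LCn n"
  show "LCn_dist n S U \<le> LCn_dist n S T + LCn_dist n T U"
  proof (rule LCn_dist_least[OF S U])
    fix v assume v: "v \<in> Cn n" "Cn_norm n v \<le> 1"
    have "Cn_norm n (\<lambda>i. S v i - U v i)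
        \<le> L2_set (\<lambda>i. cmod (S v i - T v i) + cmod (T v i - U v i)) {..<n}"
      unfolding Cn_norm_def by (rule L2_set_mono) (auto intro: norm_diff_triangle_le)
    also have "\<dots> \<le> Cn_norm n (\<lambda>i. S v i - T v i) + Cn_norm n (\<lambda>i. T v i - U v i)"
      unfolding Cn_norm_def by (rule L2_set_triangle_ineq)
    also have "\<dots> \<le> LCn_dist n S T + LCn_dist n T U"
      by (intro add_mono LCn_dist_upper S T U v)
    finally show "Cn_norm n (\<lambda>i. S v i - U v i) \<le> LCn_dist n S T + LCn_dist n T U" .
  qed
qed

definition LCn_topology :: "nat \<Rightarrow> ((nat \<Rightarrow> complex) \<Rightarrow> (nat \<Rightarrow> complex)) topology" where
  "LCn_topology n = Metric_space.mtopology (LCn n) (LCn_dist n)"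

definition LCn_compact_subgroup :: "nat \<Rightarrow> ((nat \<Rightarrow> complex) \<Rightarrow> (nat \<Rightarrow> complex)) set \<Rightarrow> bool"
where
  "LCn_compact_subgroup n S \<longleftrightarrow>
     compactin (LCn_topology n) S \<and> group \<lparr>carrier = S, mult = (\<circ>), one = Cn_id n\<rparr>"

definition coord_map :: "(nat \<Rightarrow> 'a::complex_banach) \<Rightarrow> nat \<Rightarrow> 'a \<Rightarrow> (nat \<Rightarrow> complex)" where
  "coord_map e n x = Cn_id n (coords e x)"

definition basis_embed :: "(nat \<Rightarrow> 'a::complex_banach) \<Rightarrow> nat \<Rightarrow> (nat \<Rightarrow> complex) \<Rightarrow> 'a" where
  "basis_embed e n v = (\<Sum>i<n. v i *\<^sub>C e i)"

definition compressions ::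
  "(nat \<Rightarrow> 'a::complex_banach) \<Rightarrow> ('a \<Rightarrow> 'a) set \<Rightarrow> nat \<Rightarrow> ((nat \<Rightarrow> complex) \<Rightarrow> (nat \<Rightarrow> complex)) set"
where
  "compressions e G n = {coord_map e n \<circ> g \<circ> basis_embed e n | g. g \<in> G}"


section \<open>Groups of operators\<close>

definition operators :: "('a::complex_banach \<Rightarrow> 'a) set" where
  "operators = {g. Vector_Spaces.linear (*\<^sub>C) (*\<^sub>C) g \<and> continuous_on UNIV g}"

abbreviation comp_monoid :: "('a \<Rightarrow> 'a) set \<Rightarrow> ('a \<Rightarrow> 'a) monoid" where
  "comp_monoid G \<equiv> \<lparr>carrier = G, mult = (\<circ>), one = id\<rparr>"

definition topological_operator_group ::
  "('a::complex_banach \<Rightarrow> 'a) set \<Rightarrow> ('a \<Rightarrow> 'a) topology \<Rightarrow> bool"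
where
  "topological_operator_group G \<tau> \<longleftrightarrow>
     G \<subseteq> operators \<and> group (comp_monoid G) \<and> topspace \<tau> = G \<and>
     continuous_map (prod_topology \<tau> \<tau>) \<tau> (\<lambda>(g, h). g \<circ> h) \<and>
     continuous_map \<tau> \<tau> (\<lambda>g. inv\<^bsub>comp_monoid G\<^esub> g)"

definition acts_separately_continuously ::
  "('a::complex_banach \<Rightarrow> 'a) set \<Rightarrow> ('a \<Rightarrow> 'a) topology \<Rightarrow> bool"
where
  "acts_separately_continuously G \<tau> \<longleftrightarrow>
     (\<forall>x. continuous_map \<tau> euclidean (\<lambda>g. g x)) \<and> (\<forall>g\<in>G. continuous_on UNIV g)"

definition invariant_set :: "('a \<Rightarrow> 'a) set \<Rightarrow> 'a set \<Rightarrow> bool" where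
  "invariant_set G K \<longleftrightarrow> (\<forall>g\<in>G. g ` K \<subseteq> K)"

definition invariant_fun :: "('a \<Rightarrow> 'a) set \<Rightarrow> ('a \<Rightarrow> complex) \<Rightarrow> bool" where
  "invariant_fun G P \<longleftrightarrow> (\<forall>g\<in>G. \<forall>x. P (g x) = P x)"


section \<open>Polynomials on a complex Banach space\<close>

text \<open>An \<open>m\<close>-tuple is a sequence of which only the entries below \<open>m\<close> matter.\<close>

definition multilinear_form :: "nat \<Rightarrow> ((nat \<Rightarrow> 'a::complex_banach) \<Rightarrow> complex) \<Rightarrow> bool" where
  "multilinear_form m A \<longleftrightarrow>
     (\<forall>x y. (\<forall>i<m. x i = y i) \<longrightarrow> A x = A y) \<and>
     (\<forall>i<m. \<forall>x. Vector_Spaces.linear (*\<^sub>C) (*) (\<lambda>y. A (x(i := y))))"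

definition homogeneous_polynomial_of_degree :: "nat \<Rightarrow> ('a::complex_banach \<Rightarrow> complex) \<Rightarrow> bool" where
  "homogeneous_polynomial_of_degree m P \<longleftrightarrow> (\<exists>A. multilinear_form m A \<and> P = (\<lambda>x. A (\<lambda>_. x)))"

definition homogeneous_polynomial :: "('a::complex_banach \<Rightarrow> complex) \<Rightarrow> bool" where
  "homogeneous_polynomial P \<longleftrightarrow> (\<exists>m. homogeneous_polynomial_of_degree m P)"

definition continuous_polynomial :: "('a::complex_banach \<Rightarrow> complex) \<Rightarrow> bool" where
  "continuous_polynomial P \<longleftrightarrow>
     (\<exists>N p. (\<forall>m\<le>N. homogeneous_polynomial_of_degree m (p m)) \<and> P = (\<lambda>x. \<Sum>m\<le>N. p m x)) \<and>
     continuous_on UNIV P"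

text \<open>The supremum is taken in the extended reals, so that it is infinite when \<open>P\<close> is unbounded
  on \<open>K\<close>.\<close>

definition separates :: "('a \<Rightarrow> complex) \<Rightarrow> 'a \<Rightarrow> 'a set \<Rightarrow> bool" where
  "separates P z K \<longleftrightarrow> (SUP w\<in>K. ereal (cmod (P w))) < ereal (cmod (P z))"

end

theory Submission
  imports Defs
begin

text \<open>Choose \<open>n = j n\<^sub>0\<close> so large that \<open>\<bar>Q (\<pi>\<^sub>n z)\<bar> > t\<close> for some \<open>t\<close> above \<open>r\<close> and above the supremum of
  \<open>\<bar>Q\<bar>\<close> on \<open>K\<close>, and average the polynomials \<open>x \<mapsto> Q (\<pi>\<^sub>n (g x)) ^ k\<close> over \<open>g \<in> G\<close>.  The average is a
  \<open>G\<close>-invariant polynomial, bounded on \<open>K\<close> by the \<open>k\<close>-th power of that supremum.  Since only finitely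
  many arguments occur, for suitable large \<open>k\<close> the values at \<open>z\<close> of modulus at least \<open>r\<close> all lie near the
  positive real axis, so there is no cancellation and the average at \<open>z\<close> is of order \<open>t ^ k\<close>.
  Instead of Haar measure, limits of finite averages are used: the functions \<open>g \<mapsto> Q (\<pi>\<^sub>n (g x))\<close> are almost
  periodic on \<open>G\<close>, and finite averages over left translations make such functions nearly constant.\<close>

text \<open>Compactness is known only for the compressions, while the average runs over
  \<open>G\<close>. The link is the condition on the spans of the \<open>e i\<close> with
  \<open>n \<le> i\<close>: it makes the first \<open>n\<close> coordinates of \<open>g x\<close>
  the product of the matrix of the compression of \<open>g\<close> with the first \<open>n\<close>
  coordinates of \<open>x\<close>. Compressing is therefore multiplicative, and total boundedness of
  the compressions becomes almost periodicity on \<open>G\<close>. By the same formula all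
  translates of a polynomial in these coordinates stay in one finite-dimensional space, with the
  same degrees. Finite dimension makes limits of averages exist and remain polynomials; recording
  the degrees settles the homogeneous case. Continuity of the result needs continuous coordinates,
  which the definition of a Schauder basis does not include; hence the Baire argument. Bounds on
  \<open>K\<close> survive because \<open>g\<close> and the projection both map \<open>K\<close>
  into itself. The value at \<open>z\<close> is harder: without a measure, a finite set of
  translates of \<open>z\<close>, one of which is sent by any given group element to a point where
  the polynomial is large, replaces a set of positive measure.\<close>

interpretation scaleC: vector_space "(*\<^sub>C) :: complex \<Rightarrow> 'a \<Rightarrow> 'a::complex_banach"
  by (rule vector_space_scaleC)

lemma bounded_linear_scaleC_right: "bounded_linear (\<lambda>x::'a::complex_banach. c *\<^sub>C x)"
  by (rule bounded_linear_intro[where K = "cmod c"])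
    (auto simp: scaleC_add_right norm_scaleC scaleR_scaleC scaleC_scaleC mult.commute)

lemma bounded_linear_scaleC_left: "bounded_linear (\<lambda>c. c *\<^sub>C (x::'a::complex_banach))"
  by (rule bounded_linear_intro[where K = "norm x"])
    (auto simp: scaleC_add_left norm_scaleC scaleR_scaleC scaleC_scaleC scaleR_conv_of_real)

section \<open>Continuity of the coordinates of a Schauder basis\<close>

context
  fixes e :: "nat \<Rightarrow> 'a::complex_banach"
  assumes basis: "schauder_basis e"
begin

lemma coords_sums: "(\<lambda>i. coords e x i *\<^sub>C e i) sums x"
proof -
  have "\<exists>!c. (\<lambda>i. c i *\<^sub>C e i) sums x" using basis by (simp add: schauder_basis_def)
  from theI'[OF this] show ?thesis by (simp add: coords_def)
qed

lemma coords_unique: "(\<lambda>i. c i *\<^sub>C e i) sums x \<Longrightarrow> coords e x = c"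
  using basis coords_sums[of x] unfolding schauder_basis_def by blast

lemma coords_add: "coords e (x + y) = (\<lambda>i. coords e x i + coords e y i)"
  by (rule coords_unique) (simp add: scaleC_add_left sums_add[OF coords_sums coords_sums])

lemma coords_scaleC: "coords e (a *\<^sub>C x) = (\<lambda>i. a * coords e x i)"
  using bounded_linear.sums[OF bounded_linear_scaleC_right coords_sums[of x]]
  by (intro coords_unique) (simp add: scaleC_scaleC)

lemma coords_zero: "coords e 0 = (\<lambda>i. 0)"
  by (rule coords_unique) simp

lemma coords_scaleR: "coords e (a *\<^sub>R x) = (\<lambda>i. complex_of_real a * coords e x i)"
  by (simp add: scaleR_scaleC coords_scaleC)

lemma coords_diff: "coords e (x - y) = (\<lambda>i. coords e x i - coords e y i)"
  using coords_add[of x "(-1) *\<^sub>R y"] unfolding coords_scaleR by simp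

lemma coords_sum: "coords e (sum f A) i = (\<Sum>a\<in>A. coords e (f a) i)"
  by (induction A rule: infinite_finite_induct) (simp_all add: coords_zero coords_add)

lemma coords_basis: "coords e (e k) = (\<lambda>i. if i = k then 1 else 0)"
proof (rule coords_unique)
  have "(\<lambda>i. (if i = k then 1 else 0) *\<^sub>C e i) = (\<lambda>i. if i = k then e i else 0)"
    by (auto simp: scaleC_one)
  then show "(\<lambda>i. (if i = k then 1 else 0) *\<^sub>C e i) sums e k"
    using sums_single[of k e] by simp
qed

lemma basis_nonzero: "e k \<noteq> 0"
proof
  assume "e k = 0"
  then have "coords e (e k) k = coords e 0 k" by simp
  then show False by (simp add: coords_basis coords_zero)
qed

lemma basis_proj_tendsto: "(\<lambda>n. basis_proj e n x) \<longlonglongrightarrow> x"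
  using coords_sums[of x] by (simp add: sums_def basis_proj_def)

lemma basis_proj_diff: "basis_proj e n (x - y) = basis_proj e n x - basis_proj e n y"
  by (simp add: basis_proj_def coords_diff scaleC.scale_left_diff_distrib sum_subtractf)

lemma basis_proj_scaleR: "basis_proj e n (a *\<^sub>R x) = a *\<^sub>R basis_proj e n x"
  unfolding basis_proj_def coords_scaleR by (simp add: scaleR_scaleC scaleC.scale_sum_right)

lemma coords_basis_proj: "coords e (basis_proj e n x) i = (if i < n then coords e x i else 0)"
proof -
  have "coords e (basis_proj e n x) i = (\<Sum>k<n. if k = i then coords e x k else 0)"
    unfolding basis_proj_def coords_sum coords_scaleC coords_basis by (intro sum.cong) auto
  then show ?thesis by simp
qed

text \<open>Baire's theorem, applied to the closures of the sets on which all partial sums are bounded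
  by a given \<open>M\<close>.\<close>

lemma basis_proj_bounded_dense:
  obtains \<delta> M where "\<delta> > 0" "M > 0"
    "\<And>x \<epsilon>. norm x < \<delta> \<Longrightarrow> \<epsilon> > 0 \<Longrightarrow> \<exists>y. norm (x - y) < \<epsilon> \<and> (\<forall>n. norm (basis_proj e n y) \<le> M)"
proof -
  define B where "B M = {x. \<forall>n. norm (basis_proj e n x) \<le> real M}" for M :: nat
  have "(\<Union>M. closure (B M)) = UNIV"
  proof (intro equalityI subsetI UNIV_I)
    fix x :: 'a
    have "Bseq (\<lambda>n. basis_proj e n x)"
      by (rule convergent_imp_Bseq[OF convergentI[OF basis_proj_tendsto]])
    then obtain N where N: "\<And>n. norm (basis_proj e n x) \<le> N" by (auto simp: Bseq_def)
    obtain M :: nat where "N \<le> real M" using real_arch_simple by blast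
    then have "x \<in> B M" using N by (force simp: B_def intro: order_trans)
    then show "x \<in> (\<Union>M. closure (B M))" using closure_subset by blast
  qed
  have "\<exists>M. interior (closure (B M)) \<noteq> {}"
  proof (rule ccontr)
    assume "\<not> ?thesis"
    then have "(euclidean :: 'a topology) interior_of \<Union>(range (\<lambda>M. closure (B M))) = {}"
      by (intro Baire_category_alt disjI1 completely_metrizable_space_euclidean) auto
    then show False using \<open>(\<Union>M. closure (B M)) = UNIV\<close> by simp
  qed
  then obtain M a where "a \<in> interior (closure (B M))" by blast
  then obtain \<delta> where \<delta>: "\<delta> > 0" "ball a \<delta> \<subseteq> closure (B M)"
    by (meson mem_interior)
  show ?thesis
  \<comment> \<open>Differences of approximants of \<open>a + x\<close> and of \<open>a\<close> move
    the ball from \<open>a\<close> to the origin and double the bound; the summand 1 keeps it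
    positive when \<open>M\<close> is 0.\<close>
  proof (rule that[OF \<delta>(1), of "2 * real M + 1"])
    show "2 * real M + 1 > 0" by simp
    fix x :: 'a and \<epsilon> :: real assume x: "norm x < \<delta>" and \<epsilon>: "\<epsilon> > 0"
    have "a \<in> closure (B M)" "a + x \<in> closure (B M)"
      using \<delta> x by (auto simp: subset_iff dist_norm)
    then obtain y1 y2 where y: "y1 \<in> B M" "dist y1 a < \<epsilon> / 2" "y2 \<in> B M" "dist y2 (a + x) < \<epsilon> / 2"
      using \<epsilon> by (meson closure_approachable half_gt_zero)
    have "norm (x - (y2 - y1)) = norm ((y1 - a) - (y2 - (a + x)))" by (simp add: algebra_simps)
    also have "\<dots> \<le> norm (y1 - a) + norm (y2 - (a + x))" by (rule norm_triangle_ineq4)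
    also have "\<dots> < \<epsilon>" using y by (simp add: dist_norm)
    finally have "norm (x - (y2 - y1)) < \<epsilon>" .
    moreover have "norm (basis_proj e n (y2 - y1)) \<le> 2 * real M + 1" for n
    proof -
      have "norm (basis_proj e n (y2 - y1)) \<le> norm (basis_proj e n y2) + norm (basis_proj e n y1)"
        unfolding basis_proj_diff by (rule norm_triangle_ineq4)
      also have "\<dots> \<le> real M + real M" using y by (intro add_mono) (auto simp: B_def)
      finally show ?thesis by simp
    qed
    ultimately show "\<exists>y. norm (x - y) < \<epsilon> \<and> (\<forall>n. norm (basis_proj e n y) \<le> 2 * real M + 1)"
      by blast
  qed
qed

lemma norm_coords_le: "norm (coords e x i) * norm (e i) \<le> norm (basis_proj e (Suc i) x) + norm (basis_proj e i x)"
proof -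
  have "coords e x i *\<^sub>C e i = basis_proj e (Suc i) x - basis_proj e i x"
    by (simp add: basis_proj_def)
  then show ?thesis by (metis norm_scaleC norm_triangle_ineq4)
qed

text \<open>The projections are not yet known to be continuous, so they cannot simply be passed
  through the series. Summing coordinates gives candidate coefficients; the majorant
  \<open>b\<close> does not depend on \<open>n\<close>, so the two limits may be exchanged, the
  candidates expand \<open>x\<close>, and uniqueness identifies them with its coordinates.\<close>

lemma basis_proj_suminf:
  assumes x: "u sums x" and b: "\<And>k n. norm (basis_proj e n (u k)) \<le> b k" and "summable b"
  shows "(\<lambda>k. basis_proj e n (u k)) sums basis_proj e n x"
proof -
  have sc: "summable (\<lambda>k. coords e (u k) i)" for i
  proof (rule summable_comparison_test')
    show "summable (\<lambda>k. 2 * b k / norm (e i))" using \<open>summable b\<close> by (intro summable_divide summable_mult)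
    fix k :: nat
    have "norm (coords e (u k) i) * norm (e i) \<le> 2 * b k"
      using norm_coords_le[of "u k" i] b[of i k] b[of "Suc i" k] by linarith
    then show "norm (coords e (u k) i) \<le> 2 * b k / norm (e i)"
      using basis_nonzero[of i] by (simp add: field_simps)
  qed
  define c where "c i = (\<Sum>k. coords e (u k) i)" for i
  have cs: "(\<lambda>k. basis_proj e n (u k)) sums (\<Sum>i<n. c i *\<^sub>C e i)" for n
    unfolding basis_proj_def c_def
    by (intro sums_sum bounded_linear.sums[OF bounded_linear_scaleC_left] summable_sums sc)
  have lim: "(\<lambda>n. \<Sum>i<n. c i *\<^sub>C e i) \<longlonglongrightarrow> x"
  proof (rule swap_uniform_limit')
    have "(\<lambda>n. suminf (\<lambda>k. basis_proj e n (u k))) = (\<lambda>n. \<Sum>i<n. c i *\<^sub>C e i)"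
      using cs by (simp add: sums_iff)
    moreover have "uniform_limit UNIV (\<lambda>N n. \<Sum>k<N. basis_proj e n (u k))
        (\<lambda>n. suminf (\<lambda>k. basis_proj e n (u k))) sequentially"
      by (rule Weierstrass_m_test) (use b \<open>summable b\<close> in auto)
    ultimately show "uniform_limit UNIV (\<lambda>N n. \<Sum>k<N. basis_proj e n (u k)) (\<lambda>n. \<Sum>i<n. c i *\<^sub>C e i) sequentially"
      by simp
    show "\<forall>\<^sub>F N in sequentially. ((\<lambda>n. \<Sum>k<N. basis_proj e n (u k)) \<longlongrightarrow> (\<Sum>k<N. u k)) sequentially"
      by (intro always_eventually allI tendsto_sum basis_proj_tendsto)
    show "(\<lambda>N. \<Sum>k<N. u k) \<longlonglongrightarrow> x" using x by (simp add: sums_def)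
  qed auto
  then have "coords e x = c" by (intro coords_unique) (simp add: sums_def)
  then show ?thesis using cs[of n] by (simp add: basis_proj_def)
qed

text \<open>Successive approximation as in the open mapping theorem: rescaling makes the density
  available at every scale, so \<open>x\<close> becomes a series whose terms have projections
  bounded by \<open>M / 2 ^ k\<close>.\<close>

lemma basis_proj_bounded:
  obtains C where "\<And>n x. norm (basis_proj e n x) \<le> C * norm x"
proof -
  obtain \<delta> M where \<delta>: "\<delta> > 0" "M > 0" and
    dense: "\<And>x \<epsilon>. norm x < \<delta> \<Longrightarrow> \<epsilon> > 0 \<Longrightarrow> \<exists>y. norm (x - y) < \<epsilon> \<and> (\<forall>n. norm (basis_proj e n y) \<le> M)"
    using basis_proj_bounded_dense by blast
  have small: "norm (basis_proj e n x) \<le> 2 * M" if x: "norm x < \<delta>" for n x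
  proof -
    have step: "\<exists>y. norm y < \<delta> / 2 ^ Suc k \<and> (\<forall>n. norm (basis_proj e n (u - y)) \<le> M / 2 ^ k)"
      if u: "norm u < \<delta> / 2 ^ k" for u k
    proof -
      have "norm ((2 ^ k :: real) *\<^sub>R u) < \<delta>" using u by (simp add: field_simps)
      from dense[OF this, of "\<delta> / 2"] \<delta> obtain y
        where y: "norm ((2 ^ k :: real) *\<^sub>R u - y) < \<delta> / 2" "\<And>n. norm (basis_proj e n y) \<le> M" by auto
      define w where "w = (1 / 2 ^ k :: real) *\<^sub>R y"
      have "u - w = (1 / 2 ^ k :: real) *\<^sub>R ((2 ^ k :: real) *\<^sub>R u - y)"
        by (simp add: w_def scaleR_diff_right)
      then have "norm (u - w) = norm ((2 ^ k :: real) *\<^sub>R u - y) / 2 ^ k" by simp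
      then have "norm (u - w) < \<delta> / 2 ^ Suc k" using y(1) by (simp add: divide_simps)
      moreover have "norm (basis_proj e n w) \<le> M / 2 ^ k" for n
        using y(2)[of n] by (simp add: w_def basis_proj_scaleR divide_right_mono)
      ultimately show ?thesis by (intro exI[of _ "u - w"]) simp
    qed
    \<comment> \<open>\<open>u k\<close> is what remains of \<open>x\<close> after \<open>k\<close>
      approximations; the differences are the approximants and telescope to
      \<open>x\<close>.\<close>
    obtain u where u0: "u 0 = x" and un: "\<And>k. norm (u k) < \<delta> / 2 ^ k"
      and ud: "\<And>k n. norm (basis_proj e n (u k - u (Suc k))) \<le> M / 2 ^ k"
    proof -
      have "\<exists>f. \<forall>k. (norm (f k) < \<delta> / 2 ^ k \<and> (k = 0 \<longrightarrow> f k = x)) \<and>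
          (\<forall>n. norm (basis_proj e n (f k - f (Suc k))) \<le> M / 2 ^ k)"
        by (rule dependent_nat_choice) (use x step in auto)
      then show ?thesis using that by blast
    qed
    have "u \<longlonglongrightarrow> 0"
    proof (rule Lim_null_comparison)
      show "(\<lambda>k. \<delta> / 2 ^ k) \<longlonglongrightarrow> 0"
        using tendsto_mult_right_zero[OF LIMSEQ_realpow_zero[of "1/2"], of \<delta>] by (simp add: power_divide)
    qed (use un less_imp_le in \<open>auto intro!: always_eventually\<close>)
    then have s: "(\<lambda>k. u k - u (Suc k)) sums x"
      using telescope_sums'[of u 0] u0 by simp
    have gs: "(\<lambda>k. M / 2 ^ k) sums (2 * M)"
      using sums_mult[OF geometric_sums[of "1/2::real"], of M] by (simp add: power_divide mult.commute)
    have bs: "(\<lambda>k. basis_proj e n (u k - u (Suc k))) sums basis_proj e n x"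
      by (rule basis_proj_suminf[OF s ud]) (use gs in \<open>simp add: sums_iff\<close>)
    have "norm (suminf (\<lambda>k. basis_proj e n (u k - u (Suc k)))) \<le> suminf (\<lambda>k. M / 2 ^ k)"
      by (rule norm_suminf_le) (use ud gs in \<open>auto simp: sums_iff\<close>)
    then show ?thesis using bs gs by (simp add: sums_iff)
  qed
  show ?thesis
  proof (rule that[of "4 * M / \<delta>"])
    fix n x
    show "norm (basis_proj e n x) \<le> 4 * M / \<delta> * norm x"
    proof (cases "x = 0")
      case True
      then show ?thesis by (simp add: basis_proj_def coords_zero)
    next
      case False
      define a where "a = \<delta> / (2 * norm x)"
      have a: "a > 0" using False \<delta> by (simp add: a_def)
      have "norm (a *\<^sub>R x) < \<delta>" using False \<delta> by (simp add: a_def)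
      from small[OF this, of n] a have "a * norm (basis_proj e n x) \<le> 2 * M"
        by (simp add: basis_proj_scaleR)
      then show ?thesis using False \<delta> by (simp add: a_def field_simps)
    qed
  qed
qed

text \<open>Two consecutive projections differ by one coordinate times \<open>e i\<close>, and both
  are bounded. The continuity of the invariant polynomial and the matrix description of operators
  rest on this.\<close>

lemma continuous_coords: "continuous_on UNIV (\<lambda>x. coords e x i)"
proof -
  obtain C where C: "\<And>n x. norm (basis_proj e n x) \<le> C * norm x" by (rule basis_proj_bounded) blast
  have "bounded_linear (\<lambda>x. coords e x i)"
  proof (rule bounded_linear_intro[where K = "2 * C / norm (e i)"])
    fix x
    have "norm (coords e x i) * norm (e i) \<le> 2 * C * norm x"
      using norm_coords_le[of x i] C[of i x] C[of "Suc i" x] by linarith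
    then show "norm (coords e x i) \<le> norm x * (2 * C / norm (e i))"
      using basis_nonzero[of i] by (simp add: field_simps)
  qed (simp_all add: coords_add coords_scaleR scaleR_conv_of_real)
  then show ?thesis by (rule linear_continuous_on)
qed

end

section \<open>Almost periodic functions and their averages\<close>

context group
begin

text \<open>A function is almost periodic if its right translates form a totally bounded set for the
  supremum norm; \<open>c\<close> numbers the parts of a finite partition of the group into pieces on which
  the right translates are \<open>\<epsilon>\<close>-close.\<close>

definition almost_periodic :: "('a \<Rightarrow> complex) \<Rightarrow> bool" where
  "almost_periodic f \<longleftrightarrow> (\<forall>\<epsilon>>0. \<exists>c :: 'a \<Rightarrow> nat. finite (c ` carrier G) \<and>
     (\<forall>g\<in>carrier G. \<forall>h\<in>carrier G. c g = c h \<longrightarrow>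
       (\<forall>x\<in>carrier G. cmod (f (x \<otimes> g) - f (x \<otimes> h)) \<le> \<epsilon>)))"

lemma almost_periodicE:
  assumes "almost_periodic f" "\<epsilon> > 0"
  obtains c :: "'a \<Rightarrow> nat" where "finite (c ` carrier G)"
    "\<And>g h x. \<lbrakk>g \<in> carrier G; h \<in> carrier G; x \<in> carrier G; c g = c h\<rbrakk> \<Longrightarrow> cmod (f (x \<otimes> g) - f (x \<otimes> h)) \<le> \<epsilon>"
  using assms unfolding almost_periodic_def by meson

text \<open>One representative is taken from each part; the closeness is uniform in the left factor
  \<open>x\<close>.\<close>

lemma almost_periodic_net:
  assumes "almost_periodic f" "\<epsilon> > 0"
  obtains D where "finite D" "D \<subseteq> carrier G" "D \<noteq> {}"
    "\<And>g. g \<in> carrier G \<Longrightarrow> \<exists>d\<in>D. \<forall>x\<in>carrier G. cmod (f (x \<otimes> g) - f (x \<otimes> d)) \<le> \<epsilon>"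
proof -
  obtain c :: "'a \<Rightarrow> nat" where c: "finite (c ` carrier G)"
    "\<And>g h x. \<lbrakk>g \<in> carrier G; h \<in> carrier G; x \<in> carrier G; c g = c h\<rbrakk> \<Longrightarrow> cmod (f (x \<otimes> g) - f (x \<otimes> h)) \<le> \<epsilon>"
    using almost_periodicE[OF assms] by metis
  define D where "D = inv_into (carrier G) c ` c ` carrier G"
  show ?thesis
  proof (rule that[of D])
    show "finite D" using c by (simp add: D_def)
    show "D \<subseteq> carrier G" by (auto simp: D_def inv_into_into)
    show "D \<noteq> {}" using one_closed by (auto simp: D_def)
    fix g assume g: "g \<in> carrier G"
    show "\<exists>d\<in>D. \<forall>x\<in>carrier G. cmod (f (x \<otimes> g) - f (x \<otimes> d)) \<le> \<epsilon>"
    proof (intro bexI ballI)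
      show "inv_into (carrier G) c (c g) \<in> D" using g by (simp add: D_def)
      show "cmod (f (x \<otimes> g) - f (x \<otimes> inv_into (carrier G) c (c g))) \<le> \<epsilon>" if "x \<in> carrier G" for x
        using g that by (intro c(2)) (auto simp: inv_into_into f_inv_into_f)
    qed
  qed
qed

lemma almost_periodic_bounded:
  assumes "almost_periodic f"
  obtains B where "B > 0" "\<And>g. g \<in> carrier G \<Longrightarrow> cmod (f g) \<le> B"
proof -
  obtain D where D: "finite D" "D \<subseteq> carrier G"
    "\<And>g. g \<in> carrier G \<Longrightarrow> \<exists>d\<in>D. \<forall>x\<in>carrier G. cmod (f (x \<otimes> g) - f (x \<otimes> d)) \<le> 1"
    using almost_periodic_net[OF assms, of 1] by (metis zero_less_one)
  have s0: "(\<Sum>d\<in>D. cmod (f d)) \<ge> 0" by (simp add: sum_nonneg)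
  show ?thesis
  proof (rule that[of "1 + (\<Sum>d\<in>D. cmod (f d))"])
    fix g assume g: "g \<in> carrier G"
    from D(3)[OF g] obtain d where d: "d \<in> D" "\<forall>x\<in>carrier G. cmod (f (x \<otimes> g) - f (x \<otimes> d)) \<le> 1"
      by blast
    have "cmod (f (\<one> \<otimes> g) - f (\<one> \<otimes> d)) \<le> 1" using d(2) by blast
    then have "cmod (f g - f d) \<le> 1" using d(1) g D(2) by (simp add: subset_iff)
    moreover have "cmod (f d) \<le> (\<Sum>d\<in>D. cmod (f d))"
      using d(1) D(1) by (intro member_le_sum) auto
    ultimately show "cmod (f g) \<le> 1 + (\<Sum>d\<in>D. cmod (f d))"
      using norm_triangle_sub[of "f g" "f d"] by linarith
  qed (use s0 in linarith)
qed

text \<open>The two partitions are refined to a common one, with \<open>prod_encode\<close>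
  labelling the intersections of their parts. Since \<open>comb\<close> compares values at arbitrary
  pairs, it applies to \<open>x \<otimes> g\<close> and \<open>x \<otimes> h\<close> for all
  \<open>x\<close> at once.\<close>

lemma almost_periodicI_combine:
  assumes f: "almost_periodic f1" "almost_periodic f2"
    and comb: "\<And>\<epsilon>. \<epsilon> > 0 \<Longrightarrow> \<exists>\<delta>>0. \<forall>g\<in>carrier G. \<forall>h\<in>carrier G.
      cmod (f1 g - f1 h) \<le> \<delta> \<longrightarrow> cmod (f2 g - f2 h) \<le> \<delta> \<longrightarrow> cmod (f g - f h) \<le> \<epsilon>"
  shows "almost_periodic f"
  unfolding almost_periodic_def
proof (intro allI impI)
  fix \<epsilon> :: real assume "\<epsilon> > 0"
  from comb[OF this] obtain \<delta> where \<delta>: "\<delta> > 0" "\<And>g h. \<lbrakk>g \<in> carrier G; h \<in> carrier G;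
      cmod (f1 g - f1 h) \<le> \<delta>; cmod (f2 g - f2 h) \<le> \<delta>\<rbrakk> \<Longrightarrow> cmod (f g - f h) \<le> \<epsilon>" by blast
  obtain c1 :: "'a \<Rightarrow> nat" where c1: "finite (c1 ` carrier G)"
    "\<And>g h x. \<lbrakk>g \<in> carrier G; h \<in> carrier G; x \<in> carrier G; c1 g = c1 h\<rbrakk> \<Longrightarrow> cmod (f1 (x \<otimes> g) - f1 (x \<otimes> h)) \<le> \<delta>"
    using almost_periodicE[OF f(1) \<delta>(1)] by metis
  obtain c2 :: "'a \<Rightarrow> nat" where c2: "finite (c2 ` carrier G)"
    "\<And>g h x. \<lbrakk>g \<in> carrier G; h \<in> carrier G; x \<in> carrier G; c2 g = c2 h\<rbrakk> \<Longrightarrow> cmod (f2 (x \<otimes> g) - f2 (x \<otimes> h)) \<le> \<delta>"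
    using almost_periodicE[OF f(2) \<delta>(1)] by metis
  show "\<exists>c :: 'a \<Rightarrow> nat. finite (c ` carrier G) \<and>
     (\<forall>g\<in>carrier G. \<forall>h\<in>carrier G. c g = c h \<longrightarrow>
       (\<forall>x\<in>carrier G. cmod (f (x \<otimes> g) - f (x \<otimes> h)) \<le> \<epsilon>))"
  proof (intro exI conjI ballI impI)
    have "(\<lambda>g. prod_encode (c1 g, c2 g)) ` carrier G \<subseteq> prod_encode ` (c1 ` carrier G \<times> c2 ` carrier G)"
      by auto
    then show "finite ((\<lambda>g. prod_encode (c1 g, c2 g)) ` carrier G)"
      by (rule finite_subset) (use c1 c2 in simp)
  qed (use \<delta> c1 c2 in auto)
qed

lemma almost_periodic_const: "almost_periodic (\<lambda>g. a)"
  unfolding almost_periodic_def by (auto intro!: exI[of _ "\<lambda>_. 0"] finite_subset[of _ "{0}"])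

lemma almost_periodic_add:
  assumes "almost_periodic f1" "almost_periodic f2"
  shows "almost_periodic (\<lambda>g. f1 g + f2 g)"
proof (rule almost_periodicI_combine[OF assms])
  fix \<epsilon> :: real assume "\<epsilon> > 0"
  have "cmod (f1 g + f2 g - (f1 h + f2 h)) \<le> \<epsilon>"
    if "cmod (f1 g - f1 h) \<le> \<epsilon> / 2" "cmod (f2 g - f2 h) \<le> \<epsilon> / 2" for g h
    using norm_triangle_ineq[of "f1 g - f1 h" "f2 g - f2 h"] that by (simp add: algebra_simps)
  with \<open>\<epsilon> > 0\<close> show "\<exists>\<delta>>0. \<forall>g\<in>carrier G. \<forall>h\<in>carrier G. cmod (f1 g - f1 h) \<le> \<delta> \<longrightarrow>
      cmod (f2 g - f2 h) \<le> \<delta> \<longrightarrow> cmod (f1 g + f2 g - (f1 h + f2 h)) \<le> \<epsilon>"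
    by (intro exI[of _ "\<epsilon> / 2"]) auto
qed

lemma almost_periodic_mult:
  assumes "almost_periodic f1" "almost_periodic f2"
  shows "almost_periodic (\<lambda>g. f1 g * f2 g)"
proof (rule almost_periodicI_combine[OF assms])
  fix \<epsilon> :: real assume \<epsilon>: "\<epsilon> > 0"
  obtain B1 where B1: "B1 > 0" "\<And>g. g \<in> carrier G \<Longrightarrow> cmod (f1 g) \<le> B1"
    using almost_periodic_bounded[OF assms(1)] by metis
  obtain B2 where B2: "B2 > 0" "\<And>g. g \<in> carrier G \<Longrightarrow> cmod (f2 g) \<le> B2"
    using almost_periodic_bounded[OF assms(2)] by metis
  define \<delta> where "\<delta> = \<epsilon> / (B1 + B2)"
  have \<delta>: "\<delta> > 0" using B1 B2 \<epsilon> by (simp add: \<delta>_def)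
  have "cmod (f1 g * f2 g - f1 h * f2 h) \<le> \<epsilon>"
    if "g \<in> carrier G" "h \<in> carrier G" "cmod (f1 g - f1 h) \<le> \<delta>" "cmod (f2 g - f2 h) \<le> \<delta>" for g h
  proof -
    have "f1 g * f2 g - f1 h * f2 h = f1 g * (f2 g - f2 h) + (f1 g - f1 h) * f2 h"
      by (simp add: algebra_simps)
    then have "cmod (f1 g * f2 g - f1 h * f2 h) \<le> cmod (f1 g) * cmod (f2 g - f2 h) + cmod (f1 g - f1 h) * cmod (f2 h)"
      by (metis norm_triangle_ineq norm_mult)
    also have "\<dots> \<le> B1 * \<delta> + \<delta> * B2"
      using that B1 B2 \<delta> by (intro add_mono mult_mono) auto
    also have "\<dots> = (B1 + B2) * \<delta>" by (simp add: algebra_simps)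
    also have "\<dots> = \<epsilon>" using B1 B2 by (simp add: \<delta>_def)
    finally show ?thesis .
  qed
  with \<delta> show "\<exists>\<delta>>0. \<forall>g\<in>carrier G. \<forall>h\<in>carrier G. cmod (f1 g - f1 h) \<le> \<delta> \<longrightarrow>
      cmod (f2 g - f2 h) \<le> \<delta> \<longrightarrow> cmod (f1 g * f2 g - f1 h * f2 h) \<le> \<epsilon>"
    by (intro exI[of _ \<delta>]) auto
qed

lemma almost_periodic_translate:
  assumes f: "almost_periodic f" and a: "a \<in> carrier G"
  shows "almost_periodic (\<lambda>g. f (a \<otimes> g))"
  unfolding almost_periodic_def
proof (intro allI impI)
  fix \<epsilon> :: real assume "\<epsilon> > 0"
  then obtain c :: "'a \<Rightarrow> nat" where c: "finite (c ` carrier G)"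
    "\<And>g h x. \<lbrakk>g \<in> carrier G; h \<in> carrier G; x \<in> carrier G; c g = c h\<rbrakk> \<Longrightarrow> cmod (f (x \<otimes> g) - f (x \<otimes> h)) \<le> \<epsilon>"
    using almost_periodicE[OF f] by metis
  show "\<exists>c :: 'a \<Rightarrow> nat. finite (c ` carrier G) \<and>
     (\<forall>g\<in>carrier G. \<forall>h\<in>carrier G. c g = c h \<longrightarrow>
       (\<forall>x\<in>carrier G. cmod (f (a \<otimes> (x \<otimes> g)) - f (a \<otimes> (x \<otimes> h))) \<le> \<epsilon>))"
    using c a by (intro exI[of _ c]) (auto simp flip: m_assoc)
qed

lemma almost_periodic_sum:
  "(\<And>i. i \<in> I \<Longrightarrow> almost_periodic (F i)) \<Longrightarrow> almost_periodic (\<lambda>g. \<Sum>i\<in>I. F i g)"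
  by (induction I rule: infinite_finite_induct) (simp_all add: almost_periodic_const almost_periodic_add)

text \<open>These operators stand in for integration against Haar measure. They use left
  translations only, so they commute with right translations, and each value of \<open>T f\<close>
  is a convex combination of values of \<open>f\<close>.\<close>

inductive averaging :: "(('a \<Rightarrow> complex) \<Rightarrow> ('a \<Rightarrow> complex)) \<Rightarrow> bool" where
  averaging_id: "averaging (\<lambda>f. f)"
| averaging_step: "averaging T \<Longrightarrow> finite D \<Longrightarrow> D \<noteq> {} \<Longrightarrow> D \<subseteq> carrier G \<Longrightarrow>
    averaging (\<lambda>f g. (\<Sum>d\<in>D. T f (d \<otimes> g)) / of_nat (card D))"

lemma averaging_comp:
  assumes "averaging T'" "averaging T"
  shows "averaging (\<lambda>f. T' (T f))"
  using assms(1) by induction (auto intro: averaging_step assms(2))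

text \<open>Discs as \<open>S\<close> give bounds on the modulus, half-planes give one-sided bounds
  on real parts.\<close>

lemma averaging_convex:
  assumes "averaging T" "convex S" "\<And>g. g \<in> carrier G \<Longrightarrow> f g \<in> S" "g \<in> carrier G"
  shows "T f g \<in> S"
  using assms(1,4)
proof (induction arbitrary: g)
  case averaging_id
  then show ?case using assms by simp
next
  case (averaging_step T D)
  have "(\<Sum>d\<in>D. (1 / real (card D)) *\<^sub>R T f (d \<otimes> g)) \<in> S"
    using averaging_step assms(2) by (intro convex_sum) (auto simp: subset_iff)
  then show ?case
    by (simp add: scaleR_conv_of_real sum_divide_distrib)
qed

lemma averaging_linear:
  assumes "averaging T"
  shows "T (\<lambda>g. \<Sum>i\<in>I. c i * F i g) g = (\<Sum>i\<in>I. c i * T (F i) g)"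
  using assms
proof (induction arbitrary: g)
  case (averaging_step T D)
  have "(\<Sum>d\<in>D. \<Sum>i\<in>I. c i * T (F i) (d \<otimes> g)) = (\<Sum>i\<in>I. c i * (\<Sum>d\<in>D. T (F i) (d \<otimes> g)))"
    unfolding sum_distrib_left by (rule sum.swap)
  then show ?case by (simp add: averaging_step.IH flip: sum_divide_distrib)

qed simp

lemma averaging_scale: "averaging T \<Longrightarrow> T (\<lambda>g. c * f g) = (\<lambda>g. c * T f g)"
  using averaging_linear[of T "\<lambda>_. c" "\<lambda>_. f" "{()}"] by auto

text \<open>By associativity, right translation by \<open>a\<close> commutes with the left
  translations inside \<open>T\<close>. Agreement is required on the carrier only, so
  \<open>f'\<close> may also be a function of a moved point.\<close>

lemma averaging_translate:
  assumes "averaging T" "a \<in> carrier G" "g \<in> carrier G"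
    and "\<And>g. g \<in> carrier G \<Longrightarrow> f' g = f (g \<otimes> a)"
  shows "T f' g = T f (g \<otimes> a)"
  using assms(1,3)
proof (induction arbitrary: g)
  case averaging_id
  then show ?case using assms by simp
next
  case (averaging_step T D)
  then show ?case using assms(2) by (auto simp: subset_iff m_assoc intro!: sum.cong arg_cong2[where f = divide])
qed

text \<open>A net found once for \<open>f\<close> thus serves every \<open>T f\<close> with the same
  error, which keeps the gain of a further averaging step independent of \<open>T\<close>.\<close>

lemma averaging_modulus:
  assumes "averaging T" "g \<in> carrier G" "h \<in> carrier G"
    "\<And>x. x \<in> carrier G \<Longrightarrow> cmod (f (x \<otimes> g) - f (x \<otimes> h)) \<le> \<epsilon>" "x \<in> carrier G"
  shows "cmod (T f (x \<otimes> g) - T f (x \<otimes> h)) \<le> \<epsilon>"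
proof -
  have "T (\<lambda>x. f (x \<otimes> g) - f (x \<otimes> h)) x \<in> cball 0 \<epsilon>"
    by (rule averaging_convex[OF assms(1)]) (use assms in auto)
  moreover have "T (\<lambda>x. f (x \<otimes> g) - f (x \<otimes> h)) x = T (\<lambda>x. f (x \<otimes> g)) x - T (\<lambda>x. f (x \<otimes> h)) x"
    \<comment> \<open>The difference is written as a sum over the two Booleans with coefficients 1
      and -1.\<close>
    using averaging_linear[OF assms(1), of "\<lambda>b. if b then 1 else -1"
      "\<lambda>b x. if b then f (x \<otimes> g) else f (x \<otimes> h)" UNIV x] by (simp add: UNIV_bool)
  ultimately show ?thesis
    using averaging_translate[OF assms(1,2,5), of "\<lambda>x. f (x \<otimes> g)" f]
      averaging_translate[OF assms(1,3,5), of "\<lambda>x. f (x \<otimes> h)" f] by simp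
qed

text \<open>Values of \<open>T f\<close> are convex combinations of values of \<open>f\<close>.
  Hence later averaging never spoils what was gained for one function while another is
  treated.\<close>

lemma averaging_oscillation:
  assumes T: "averaging T" and gh: "g \<in> carrier G" "h \<in> carrier G"
    and osc: "\<And>g h. g \<in> carrier G \<Longrightarrow> h \<in> carrier G \<Longrightarrow> Re (f g) - Re (f h) \<le> \<epsilon>"
  shows "Re (T f g) - Re (T f h) \<le> \<epsilon>"
proof -
  have c1: "convex {w. Re w \<le> a}" for a by (rule convex_halfspace_Re_le)
  have c2: "convex {w. Re w \<ge> a}" for a by (rule convex_halfspace_Re_ge)
  have "Re (T f g) \<le> \<epsilon> + Re (f h')" if "h' \<in> carrier G" for h'
    using averaging_convex[OF T c1, of f "\<epsilon> + Re (f h')" g] osc[OF _ that] gh by (force simp: algebra_simps)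
  then have "T f h \<in> {w. Re w \<ge> Re (T f g) - \<epsilon>}"
    by (intro averaging_convex[OF T c2] gh) (force simp: algebra_simps)
  then show ?thesis by simp
qed

text \<open>If the oscillation of \<open>Re (T f)\<close> exceeds \<open>\<epsilon>\<close> and \<open>Re (T f)\<close> comes close to its lower bound at
  \<open>u\<close>, then averaging over the translations \<open>u \<otimes> inv d\<close>, with \<open>d\<close> in an \<open>\<epsilon>/4\<close>-net of \<open>f\<close>, lowers the
  upper bound by an amount that does not depend on \<open>T\<close>.\<close>

lemma averaging_small_oscillation_Re:
  assumes f: "almost_periodic f" and \<epsilon>: "\<epsilon> > 0"
  shows "\<exists>T. averaging T \<and> (\<forall>g\<in>carrier G. \<forall>h\<in>carrier G. Re (T f g) - Re (T f h) \<le> \<epsilon>)"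
proof -
  obtain D where D: "finite D" "D \<subseteq> carrier G" "D \<noteq> {}"
    "\<And>g. g \<in> carrier G \<Longrightarrow> \<exists>d\<in>D. \<forall>x\<in>carrier G. cmod (f (x \<otimes> g) - f (x \<otimes> d)) \<le> \<epsilon> / 4"
    using almost_periodic_net[OF f, of "\<epsilon> / 4"] \<epsilon> by (metis zero_less_divide_iff zero_less_numeral)
  define M where "M = real (card D)"
  have M: "M \<ge> 1" using D by (simp add: M_def Suc_leI card_gt_0_iff)
  \<comment> \<open>A mean of at most \<open>M\<close> terms bounded by \<open>b\<close>, one of
    which is at least \<epsilon>/4 below \<open>b\<close>, is at most
    \<open>b - \<epsilon> / (4 * M)\<close>.\<close>
  define \<eta> where "\<eta> = \<epsilon> / (4 * M)"
  have \<eta>: "\<eta> > 0" "\<eta> \<le> \<epsilon> / 4" using M \<epsilon> by (auto simp: \<eta>_def field_simps)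
  obtain B where B: "B > 0" "\<And>g. g \<in> carrier G \<Longrightarrow> cmod (f g) \<le> B"
    using almost_periodic_bounded[OF f] by metis
  have step: "\<exists>T a b. averaging T \<and> (\<forall>g\<in>carrier G. a \<le> Re (T f g) \<and> Re (T f g) \<le> b) \<and>
      b - a \<le> max \<epsilon> (2 * B - real N * \<eta>)" for N
  proof (induction N)
    case 0
    have "- B \<le> Re (f g) \<and> Re (f g) \<le> B" if "g \<in> carrier G" for g
      using B(2)[OF that] abs_Re_le_cmod[of "f g"] by linarith
    then show ?case using averaging_id by (intro exI[of _ "\<lambda>f. f"] exI[of _ "-B"] exI[of _ B]) auto
  next
    case (Suc N)
    then obtain T a b where T: "averaging T" and ab: "\<And>g. g \<in> carrier G \<Longrightarrow> a \<le> Re (T f g) \<and> Re (T f g) \<le> b"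
      and ba: "b - a \<le> max \<epsilon> (2 * B - real N * \<eta>)" by blast
    show ?case
    proof (cases "b - a \<le> \<epsilon>")
      case True
      then show ?thesis using T ab by (intro exI[of _ T] exI[of _ a] exI[of _ b]) auto
    next
      case False
      show ?thesis
      \<comment> \<open>If all values stay away from \<open>a\<close>, raising the lower bound by
        \<epsilon>/2, which exceeds \<open>\<eta>\<close>, is progress enough; otherwise some
        \<open>u\<close> has a value close to \<open>a\<close>.\<close>
      proof (cases "\<forall>g\<in>carrier G. a + \<epsilon> / 2 \<le> Re (T f g)")
        case True
        then show ?thesis using T ab ba False \<eta>
          by (intro exI[of _ T] exI[of _ "a + \<epsilon> / 2"] exI[of _ b]) (auto simp: algebra_simps)
      next
        case no: False
        then obtain u where u: "u \<in> carrier G" "Re (T f u) < a + \<epsilon> / 2" by force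
        define E where "E = (\<lambda>d. u \<otimes> inv d) ` D"
        have E: "finite E" "E \<noteq> {}" "E \<subseteq> carrier G" using D u by (auto simp: E_def)
        have cE: "0 < card E" using E by (simp add: card_gt_0_iff)
        have cM: "real (card E) \<le> M"
          unfolding M_def E_def of_nat_le_iff by (rule card_image_le[OF D(1)])
        define T' where "T' = (\<lambda>f g. (\<Sum>d\<in>E. T f (d \<otimes> g)) / of_nat (card E))"
        have T': "averaging T'" unfolding T'_def by (rule averaging_step[OF T E])
        have "a \<le> Re (T' f g) \<and> Re (T' f g) \<le> b - \<eta>" if g: "g \<in> carrier G" for g
        proof
          have ReT': "Re (T' f g) = (\<Sum>d\<in>E. Re (T f (d \<otimes> g))) / card E"
            by (simp add: T'_def Re_divide_of_nat)
          have "(\<Sum>d\<in>E. a) \<le> (\<Sum>d\<in>E. Re (T f (d \<otimes> g)))"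
            using E g ab by (intro sum_mono) (auto simp: subset_iff)
          then show "a \<le> Re (T' f g)" using cE by (simp add: ReT' field_simps)
          obtain d where d: "d \<in> D" "\<forall>x\<in>carrier G. cmod (f (x \<otimes> g) - f (x \<otimes> d)) \<le> \<epsilon> / 4"
            using D(4)[OF g] by blast
          let ?d = "u \<otimes> inv d"
          have dc: "d \<in> carrier G" using d D by blast
          have dE: "?d \<in> E" using d by (simp add: E_def)
          have "cmod (T f (?d \<otimes> g) - T f (?d \<otimes> d)) \<le> \<epsilon> / 4"
            by (rule averaging_modulus[OF T g dc]) (use d u dc in auto)
          \<comment> \<open>The translation \<open>?d\<close> carries \<open>d\<close> to
            \<open>u\<close>, and \<open>g\<close> is close to \<open>d\<close>; so this one term is
            at most \<open>a + 3 * \<epsilon> / 4\<close>, which is at least \<epsilon>/4 below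
            \<open>b\<close> because \<open>b - a > \<epsilon>\<close>.\<close>
          moreover have "?d \<otimes> d = u" using u dc by (simp add: m_assoc)
          ultimately have "Re (T f (?d \<otimes> g)) \<le> a + 3 * \<epsilon> / 4"
            using abs_Re_le_cmod[of "T f (?d \<otimes> g) - T f u"] u by auto
          moreover have "(\<Sum>d\<in>E - {?d}. Re (T f (d \<otimes> g))) \<le> (\<Sum>d\<in>E - {?d}. b)"
            using E g ab by (intro sum_mono) (auto simp: subset_iff)
          moreover have "(\<Sum>d\<in>E - {?d}. b) = (real (card E) - 1) * b"
            using E dE cE by (simp add: card_Diff_singleton of_nat_diff)
          moreover have "(\<Sum>d\<in>E. Re (T f (d \<otimes> g))) = Re (T f (?d \<otimes> g)) + (\<Sum>d\<in>E - {?d}. Re (T f (d \<otimes> g)))"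
            by (rule sum.remove) (use E dE in auto)
          ultimately have "(\<Sum>d\<in>E. Re (T f (d \<otimes> g))) \<le> real (card E) * b - (b - a - 3 * \<epsilon> / 4)"
            by (simp add: algebra_simps)
          also have "\<dots> \<le> real (card E) * b - \<epsilon> / 4" using False by simp
          also have "\<epsilon> / 4 = M * \<eta>" using M by (simp add: \<eta>_def)
          also have "real (card E) * b - M * \<eta> \<le> real (card E) * b - real (card E) * \<eta>"
            using cM \<eta> by simp
          finally show "Re (T' f g) \<le> b - \<eta>" using cE by (simp add: ReT' field_simps)
        qed
        moreover have "b - \<eta> - a \<le> max \<epsilon> (2 * B - real (Suc N) * \<eta>)"
          using ba False by (simp add: algebra_simps)
        ultimately show ?thesis using T' by blast
      qed
    qed
  qed
  obtain N :: nat where "2 * B / \<eta> \<le> real N" using real_arch_simple by blast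
  then have "2 * B - real N * \<eta> \<le> \<epsilon>" using \<eta> \<epsilon> by (simp add: field_simps)
  then have "max \<epsilon> (2 * B - real N * \<eta>) = \<epsilon>" by simp
  with step[of N] obtain T a b where T: "averaging T" "\<And>g. g \<in> carrier G \<Longrightarrow> a \<le> Re (T f g) \<and> Re (T f g) \<le> b"
    "b - a \<le> \<epsilon>" by metis
  show ?thesis
  proof (intro exI[of _ T] conjI ballI T(1))
    fix g h assume "g \<in> carrier G" "h \<in> carrier G"
    then show "Re (T f g) - Re (T f h) \<le> \<epsilon>" using T(2)[of g] T(2)[of h] T(3) by linarith
  qed
qed

lemma almost_periodic_averaging: "averaging T \<Longrightarrow> almost_periodic f \<Longrightarrow> almost_periodic (T f)"
proof (induction rule: averaging.induct)
  case (averaging_step T D)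
  have "almost_periodic (\<lambda>g. (\<Sum>d\<in>D. T f (d \<otimes> g)) * (1 / of_nat (card D)))"
    using averaging_step
    by (intro almost_periodic_mult almost_periodic_const almost_periodic_sum almost_periodic_translate) auto
  then show ?case by simp
qed simp

lemma averaging_small_oscillation_Re_finite:
  assumes "finite F" "\<And>f. f \<in> F \<Longrightarrow> almost_periodic f" and \<epsilon>: "\<epsilon> > 0"
  shows "\<exists>T. averaging T \<and> (\<forall>f\<in>F. \<forall>g\<in>carrier G. \<forall>h\<in>carrier G. Re (T f g) - Re (T f h) \<le> \<epsilon>)"
  using assms(1,2)
proof (induction F)
  case empty
  then show ?case using averaging_id by blast
next
  case (insert f F)
  then obtain T where T: "averaging T" and
    TF: "\<forall>f\<in>F. \<forall>g\<in>carrier G. \<forall>h\<in>carrier G. Re (T f g) - Re (T f h) \<le> \<epsilon>" by auto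
  have "almost_periodic (T f)" by (rule almost_periodic_averaging[OF T insert.prems]) simp
  from averaging_small_oscillation_Re[OF this \<epsilon>] obtain T' where T': "averaging T'"
    "\<forall>g\<in>carrier G. \<forall>h\<in>carrier G. Re (T' (T f) g) - Re (T' (T f) h) \<le> \<epsilon>"
    by blast
  show ?case
  proof (intro exI[of _ "\<lambda>f. T' (T f)"] conjI ballI)
    show "averaging (\<lambda>f. T' (T f))" by (rule averaging_comp[OF T'(1) T])
    fix f' g h assume "f' \<in> insert f F" "g \<in> carrier G" "h \<in> carrier G"
    then show "Re (T' (T f') g) - Re (T' (T f') h) \<le> \<epsilon>"
      using T'(2) TF by (auto intro: averaging_oscillation[OF T'(1)])
  qed
qed

lemma averaging_small_oscillation:
  assumes F: "finite F" "\<And>f. f \<in> F \<Longrightarrow> almost_periodic f" and \<epsilon>: "\<epsilon> > 0"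
  shows "\<exists>T. averaging T \<and> (\<forall>f\<in>F. \<forall>g\<in>carrier G. \<forall>h\<in>carrier G. cmod (T f g - T f h) \<le> \<epsilon>)"
proof -
  \<comment> \<open>The real part of \<open>- \<i> * f g\<close> is the imaginary part of
    \<open>f g\<close>, so control of real parts on the larger family controls both parts on
    \<open>F\<close>.\<close>
  let ?F = "F \<union> (\<lambda>f g. - \<i> * f g) ` F"
  have "finite ?F" using F by simp
  moreover have "almost_periodic f" if "f \<in> ?F" for f
    using that F almost_periodic_mult[OF almost_periodic_const[of "- \<i>"]] by blast
  ultimately have "\<exists>T. averaging T \<and> (\<forall>f\<in>?F. \<forall>g\<in>carrier G. \<forall>h\<in>carrier G. Re (T f g) - Re (T f h) \<le> \<epsilon> / 2)"
    using \<epsilon> by (intro averaging_small_oscillation_Re_finite) simp_all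
  then obtain T where T: "averaging T" and
    osc: "\<And>f g h. \<lbrakk>f \<in> ?F; g \<in> carrier G; h \<in> carrier G\<rbrakk> \<Longrightarrow> Re (T f g) - Re (T f h) \<le> \<epsilon> / 2"
    by blast
  show ?thesis
  proof (intro exI[of _ T] conjI ballI T)
    fix f g h assume f: "f \<in> F" and gh: "g \<in> carrier G" "h \<in> carrier G"
    have re: "Re (T f g - T f h) \<le> \<epsilon> / 2" "- Re (T f g - T f h) \<le> \<epsilon> / 2"
      using osc[of f g h] osc[of f h g] f gh by auto
    have eq: "T (\<lambda>g. - \<i> * f g) = (\<lambda>g. - \<i> * T f g)" by (rule averaging_scale[OF T])
    have "(\<lambda>g. - \<i> * f g) \<in> ?F" using f by blast
    from osc[OF this gh] osc[OF this gh(2,1)]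
    have im: "Im (T f g - T f h) \<le> \<epsilon> / 2" "- Im (T f g - T f h) \<le> \<epsilon> / 2"
      unfolding eq by auto
    show "cmod (T f g - T f h) \<le> \<epsilon>"
      using cmod_le[of "T f g - T f h"] re im by linarith
  qed
qed

end

section \<open>Invariant averages in finite-dimensional function spaces\<close>

inductive_set fun_span :: "('x \<Rightarrow> complex) set \<Rightarrow> ('x \<Rightarrow> complex) set" for B where
  fun_span_zero: "(\<lambda>x. 0) \<in> fun_span B"
| fun_span_step: "b \<in> B \<Longrightarrow> f \<in> fun_span B \<Longrightarrow> (\<lambda>x. c * b x + f x) \<in> fun_span B"

lemma fun_span_scaled_base: "b \<in> B \<Longrightarrow> (\<lambda>x. c * b x) \<in> fun_span B"
  using fun_span_step[OF _ fun_span_zero, of b B c] by simp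

lemma fun_span_base: "b \<in> B \<Longrightarrow> b \<in> fun_span B"
  using fun_span_scaled_base[of b B 1] by simp

lemma fun_span_add: "f \<in> fun_span B \<Longrightarrow> g \<in> fun_span B \<Longrightarrow> (\<lambda>x. f x + g x) \<in> fun_span B"
proof (induction rule: fun_span.induct)
  case (fun_span_step b f c)
  then have "(\<lambda>x. c * b x + (f x + g x)) \<in> fun_span B" by (intro fun_span.fun_span_step) auto
  then show ?case by (simp add: add.assoc)
qed simp

lemma fun_span_scale: "f \<in> fun_span B \<Longrightarrow> (\<lambda>x. a * f x) \<in> fun_span B"
proof (induction rule: fun_span.induct)
  case (fun_span_step b f c)
  then have "(\<lambda>x. (a * c) * b x + a * f x) \<in> fun_span B" by (intro fun_span.fun_span_step) auto
  then show ?case by (simp add: algebra_simps)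
qed (simp add: fun_span_zero)

lemma fun_span_sum: "(\<And>i. i \<in> I \<Longrightarrow> F i \<in> fun_span B) \<Longrightarrow> (\<lambda>x. \<Sum>i\<in>I. F i x) \<in> fun_span B"
  by (induction I rule: infinite_finite_induct) (simp_all add: fun_span_zero fun_span_add)

lemma fun_span_minimal:
  assumes "f \<in> fun_span B" "B \<subseteq> fun_span C"
  shows "f \<in> fun_span C"
  using assms(1)
proof induction
  case (fun_span_step b f c)
  then show ?case using assms(2) by (intro fun_span_add fun_span_scale) auto
qed (rule fun_span_zero)

lemma fun_span_mono: "f \<in> fun_span B \<Longrightarrow> B \<subseteq> C \<Longrightarrow> f \<in> fun_span C"
  by (erule fun_span_minimal) (auto intro: fun_span_base)

lemma fun_span_insert:
  assumes "f \<in> fun_span (insert b B)"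
  shows "\<exists>c. \<exists>h\<in>fun_span B. f = (\<lambda>x. c * b x + h x)"
  using assms
proof induction
  case fun_span_zero
  show ?case by (intro exI[of _ 0] bexI[of _ "\<lambda>x. 0"]) (auto intro: fun_span.fun_span_zero)
next
  case (fun_span_step b' f a)
  then obtain c h where h: "h \<in> fun_span B" "f = (\<lambda>x. c * b x + h x)" by blast
  show ?case
  proof (cases "b' = b")
    case True
    then show ?thesis using h
      by (intro exI[of _ "a + c"] bexI[of _ h]) (auto simp: algebra_simps)
  next
    case False
    then have "(\<lambda>x. a * b' x + h x) \<in> fun_span B"
      using h fun_span_step(1) by (intro fun_span.fun_span_step) auto
    moreover have "(\<lambda>x. a * b' x + f x) = (\<lambda>x. c * b x + (a * b' x + h x))"
      by (simp add: h(2) algebra_simps)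
    ultimately show ?thesis
      by (intro exI[of _ c] bexI[of _ "\<lambda>x. a * b' x + h x"])
  qed
qed

text \<open>A point where the part of \<open>b\<close> not yet interpolated does not vanish is added to the nodes.\<close>

lemma fun_span_interpolation:
  assumes "finite B"
  shows "\<exists>N p \<phi>. (\<forall>i<N. \<phi> i \<in> fun_span B) \<and> (\<forall>f\<in>fun_span B. \<forall>x. f x = (\<Sum>i<N::nat. f (p i) * \<phi> i x))"
  using assms
proof (induction B)
  case empty
  have "f = (\<lambda>x. 0)" if "f \<in> fun_span {}" for f :: "'a \<Rightarrow> complex"
    using that by induction auto
  then show ?case by (intro exI[of _ 0]) auto
next
  case (insert b B)
  from insert.IH obtain N :: nat and p \<phi> where \<phi>: "\<forall>i<N. \<phi> i \<in> fun_span B"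
    and "\<forall>f\<in>fun_span B. \<forall>x. f x = (\<Sum>i<N. f (p i) * \<phi> i x)" by blast
  then have eq: "f x = (\<Sum>i<N. f (p i) * \<phi> i x)" if "f \<in> fun_span B" for f x using that by blast
  have sub: "f \<in> fun_span (insert b B)" if "f \<in> fun_span B" for f
    using that by (rule fun_span_mono) blast
  \<comment> \<open>\<open>b'\<close> is the error of interpolating \<open>b\<close> at the old
    nodes. Elements of \<open>fun_span B\<close> have no such error, so every error in the larger
    span is a multiple of \<open>b'\<close>.\<close>
  define b' where "b' = (\<lambda>x. b x - (\<Sum>i<N. b (p i) * \<phi> i x))"
  have b': "b' \<in> fun_span (insert b B)"
  proof -
    have "(\<lambda>x. 1 * b x + (\<Sum>i<N. (- b (p i)) * \<phi> i x)) \<in> fun_span (insert b B)"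
      by (intro fun_span_step fun_span_sum fun_span_scale sub) (use \<phi> in auto)
    then show ?thesis by (simp add: b'_def sum_negf)
  qed
  have err: "\<exists>c. \<forall>x. f x = c * b' x + (\<Sum>i<N. f (p i) * \<phi> i x)" if f: "f \<in> fun_span (insert b B)" for f
  proof -
    obtain c h where h: "h \<in> fun_span B" "f = (\<lambda>x. c * b x + h x)"
      using fun_span_insert[OF f] by blast
    have "f x = c * b' x + (\<Sum>i<N. f (p i) * \<phi> i x)" for x
      using eq[OF h(1), of x]
      by (simp add: h(2) b'_def algebra_simps sum.distrib sum_distrib_left)
    then show ?thesis by blast
  qed
  show ?case
  proof (cases "\<exists>q. b' q \<noteq> 0")
    case False
    have "f x = (\<Sum>i<N. f (p i) * \<phi> i x)" if f: "f \<in> fun_span (insert b B)" for f x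
    proof -
      obtain c where c: "f x = c * b' x + (\<Sum>i<N. f (p i) * \<phi> i x)" using err[OF f] by blast
      then show ?thesis using False by simp
    qed
    then show ?thesis using \<phi> sub by (intro exI[of _ N] exI[of _ p] exI[of _ \<phi>]) simp
  next
    case True
    then obtain q where q: "b' q \<noteq> 0" by blast
    \<comment> \<open>The new function \<open>b' / b' q\<close> equals 1 at \<open>q\<close>; from
      each old \<open>\<phi> i\<close> the multiple of it is subtracted that makes the result vanish
      at \<open>q\<close>.\<close>
    define \<psi> where "\<psi> i = (\<lambda>x. (if i = N then 0 else \<phi> i x) + (if i = N then 1 else - \<phi> i q) / b' q * b' x)" for i
    have "\<psi> i \<in> fun_span (insert b B)" if "i < Suc N" for i
      unfolding \<psi>_def
    proof (intro fun_span_add fun_span_scale b')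
      show "(\<lambda>x. if i = N then 0 else \<phi> i x) \<in> fun_span (insert b B)"
        using that \<phi> sub by (cases "i = N") (auto simp: fun_span_zero)
    qed
    moreover have "f x = (\<Sum>i<Suc N. f ((p(N := q)) i) * \<psi> i x)" if f: "f \<in> fun_span (insert b B)" for f x
    proof -
      obtain c where c: "\<And>x. f x = c * b' x + (\<Sum>i<N. f (p i) * \<phi> i x)" using err[OF f] by blast
      have "(\<Sum>i<N. f ((p(N := q)) i) * \<psi> i x) = (\<Sum>i<N. f (p i) * \<phi> i x - f (p i) * \<phi> i q * (b' x / b' q))"
        by (intro sum.cong) (auto simp: \<psi>_def algebra_simps)
      also have "\<dots> = (\<Sum>i<N. f (p i) * \<phi> i x) - (\<Sum>i<N. f (p i) * \<phi> i q) * (b' x / b' q)"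
        by (simp only: sum_subtractf sum_distrib_right)
      also have "(\<Sum>i<N. f (p i) * \<phi> i q) = f q - c * b' q" using c[of q] by simp
      finally show ?thesis using q c[of x] by (simp add: \<psi>_def field_simps)
    qed
    ultimately show ?thesis by (intro exI[of _ "Suc N"] exI[of _ "p(N := q)"] exI[of _ \<psi>]) blast
  qed
qed

text \<open>Bolzano-Weierstrass, thinning once per index. It serves both for the limit of the
  averages and for the powers of finitely many unimodular numbers.\<close>

lemma finite_common_convergent_subsequence:
  fixes s :: "'i \<Rightarrow> nat \<Rightarrow> 'b::heine_borel"
  assumes "finite I" "\<And>i. i \<in> I \<Longrightarrow> bounded (range (s i))"
  shows "\<exists>\<rho>. strict_mono (\<rho> :: nat \<Rightarrow> nat) \<and> (\<forall>i\<in>I. convergent (\<lambda>l. s i (\<rho> l)))"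
  using assms
proof (induction I)
  case empty
  show ?case by (intro exI[of _ id]) (auto simp: strict_mono_def)
next
  case (insert i I)
  then obtain \<rho> :: "nat \<Rightarrow> nat" where \<rho>: "strict_mono \<rho>" "\<forall>i\<in>I. convergent (\<lambda>l. s i (\<rho> l))" by auto
  have "bounded (range (s i \<circ> \<rho>))"
    by (rule bounded_subset[OF insert.prems[of i]]) auto
  then obtain l \<sigma> where \<sigma>: "strict_mono (\<sigma> :: nat \<Rightarrow> nat)" "((s i \<circ> \<rho>) \<circ> \<sigma>) \<longlonglongrightarrow> l"
    using bounded_imp_convergent_subsequence by blast
  have "convergent (\<lambda>l. s k (\<rho> (\<sigma> l)))" if "k \<in> insert i I" for k
  proof (cases "k = i")
    case True
    then show ?thesis using \<sigma>(2) by (auto simp: convergent_def o_def)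
  next
    case False
    then have "convergent (\<lambda>l. s k (\<rho> l))" using that \<rho>(2) by blast
    from convergent_subseq_convergent[OF this \<sigma>(1)] show ?thesis by (simp add: o_def)
  qed
  then show ?case using strict_mono_o[OF \<rho>(1) \<sigma>(1)] unfolding o_def by blast
qed

context group
begin

lemma averaging_cong:
  assumes "averaging T" "\<And>g. g \<in> carrier G \<Longrightarrow> f g = f' g" "g \<in> carrier G"
  shows "T f g = T f' g"
  using averaging_translate[OF assms(1) one_closed assms(3), of f f'] assms(2,3) by simp

text \<open>By interpolation, all the functions \<open>\<lambda>g. F (act g x)\<close> are combinations of finitely many of them.
  One averaging operator therefore makes all of them nearly constant, and a limit point of such
  averages of \<open>F\<close> is an invariant function that stays in the span of \<open>B\<close>.\<close>

lemma invariant_average: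
  fixes F :: "'x \<Rightarrow> complex" and act :: "'a \<Rightarrow> 'x \<Rightarrow> 'x"
  assumes act: "\<And>g h x. g \<in> carrier G \<Longrightarrow> h \<in> carrier G \<Longrightarrow> act (g \<otimes> h) x = act g (act h x)"
    and B: "finite B" "\<And>g. g \<in> carrier G \<Longrightarrow> (\<lambda>x. F (act g x)) \<in> fun_span B"
    and ap: "\<And>x. almost_periodic (\<lambda>g. F (act g x))"
  shows "\<exists>P\<in>fun_span B. (\<forall>g\<in>carrier G. \<forall>x. P (act g x) = P x) \<and>
    (\<forall>D S x. finite D \<longrightarrow> D \<subseteq> carrier G \<longrightarrow> closed S \<longrightarrow> convex S \<longrightarrow>
      (\<forall>g\<in>carrier G. (\<Sum>d\<in>D. F (act g (act d x))) \<in> S) \<longrightarrow> of_nat (card D) * P x \<in> S)"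
proof -
  obtain N :: nat and p \<phi> where \<phi>: "\<forall>i<N. \<phi> i \<in> fun_span B"
    and rep: "\<forall>f\<in>fun_span B. \<forall>x. f x = (\<Sum>i<N. f (p i) * \<phi> i x)"
    using fun_span_interpolation[OF B(1)] by blast
  have interp: "F (act g x) = (\<Sum>i<N. \<phi> i x * F (act g (p i)))" if "g \<in> carrier G" for g x
    using rep[THEN bspec, OF B(2)[OF that], THEN spec, of x] by (simp only: mult.commute)
  have "\<exists>T. averaging T \<and> (\<forall>f\<in>(\<lambda>i g. F (act g (p i))) ` {..<N}. \<forall>g\<in>carrier G. \<forall>h\<in>carrier G.
      cmod (T f g - T f h) \<le> 1 / real (Suc l))" for l
    by (rule averaging_small_oscillation) (use ap in auto)
  then have "\<forall>l. \<exists>T. averaging T \<and> (\<forall>f\<in>(\<lambda>i g. F (act g (p i))) ` {..<N}. \<forall>g\<in>carrier G. \<forall>h\<in>carrier G.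
      cmod (T f g - T f h) \<le> 1 / real (Suc l))" by (rule allI)
  from choice[OF this] obtain T where T': "\<forall>l. averaging (T l) \<and>
      (\<forall>f\<in>(\<lambda>i g. F (act g (p i))) ` {..<N}. \<forall>g\<in>carrier G. \<forall>h\<in>carrier G.
      cmod (T l f g - T l f h) \<le> 1 / real (Suc l))" ..
  then have T: "averaging (T l)" for l by blast
  have osc: "cmod (T l (\<lambda>g. F (act g (p i))) g - T l (\<lambda>g. F (act g (p i))) h) \<le> 1 / real (Suc l)"
    if "i < N" "g \<in> carrier G" "h \<in> carrier G" for l i g h
    using T' that by blast
  define u where "u l x = T l (\<lambda>g. F (act g x)) \<one>" for l x
  have T_interp: "T l (\<lambda>g. F (act g x)) a = (\<Sum>i<N. \<phi> i x * T l (\<lambda>g. F (act g (p i))) a)"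
    if "a \<in> carrier G" for l x a
  proof -
    have "T l (\<lambda>g. F (act g x)) a = T l (\<lambda>g. \<Sum>i<N. \<phi> i x * F (act g (p i))) a"
      by (rule averaging_cong[OF T]) (use that interp in auto)
    then show ?thesis by (simp only: averaging_linear[OF T])
  qed
  \<comment> \<open>Evaluating the average at \<open>a\<close> instead of the identity amounts to
    moving the point to \<open>act a x\<close>. Near constancy on the group therefore becomes near
    invariance in \<open>x\<close>.\<close>
  have u_act: "u l (act a x) = T l (\<lambda>g. F (act g x)) a" if "a \<in> carrier G" for l a x
    using averaging_translate[OF T that one_closed, of "\<lambda>g. F (act g (act a x))" "\<lambda>g. F (act g x)" l] that
    by (simp add: u_def act)
  have "bounded (range (\<lambda>l. u l (p i)))" for i
  proof -
    obtain C where C: "\<And>g. g \<in> carrier G \<Longrightarrow> cmod (F (act g (p i))) \<le> C"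
      using almost_periodic_bounded[OF ap[of "p i"]] by metis
    have "u l (p i) \<in> cball 0 C" for l
      unfolding u_def by (rule averaging_convex[OF T]) (use C in auto)
    then show ?thesis by (auto simp: bounded_iff)
  qed
  then obtain \<rho> :: "nat \<Rightarrow> nat" where \<rho>: "strict_mono \<rho>" "\<forall>i\<in>{..<N}. convergent (\<lambda>l. u (\<rho> l) (p i))"
    using finite_common_convergent_subsequence[of "{..<N}" "\<lambda>i l. u l (p i)"] by blast
  then obtain L where L: "\<And>i. i < N \<Longrightarrow> (\<lambda>l. u (\<rho> l) (p i)) \<longlonglongrightarrow> L i"
    by (simp add: convergent_def Ball_def) metis
  define P where "P x = (\<Sum>i<N. L i * \<phi> i x)" for x
  have lim: "(\<lambda>l. u (\<rho> l) x) \<longlonglongrightarrow> P x" for x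
  proof -
    have "(\<lambda>l. \<Sum>i<N. \<phi> i x * u (\<rho> l) (p i)) \<longlonglongrightarrow> (\<Sum>i<N. \<phi> i x * L i)"
      by (intro tendsto_sum tendsto_mult tendsto_const L) simp
    then show ?thesis
      by (simp add: P_def u_def T_interp[OF one_closed, of _ x] mult.commute)
  qed
  have inv: "P (act a x) = P x" if a: "a \<in> carrier G" for a x
  proof -
    have lim0: "(\<lambda>l. u (\<rho> l) (act a x) - u (\<rho> l) x) \<longlonglongrightarrow> 0"
    proof (rule Lim_null_comparison)
      have "cmod (u l (act a x) - u l x) \<le> (\<Sum>i<N. cmod (\<phi> i x)) * (1 / real (Suc l))" for l
      proof -
        have e1: "u l (act a x) = (\<Sum>i<N. \<phi> i x * T l (\<lambda>g. F (act g (p i))) a)"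
          unfolding u_act[OF a] by (rule T_interp[OF a])
        have e2: "u l x = (\<Sum>i<N. \<phi> i x * T l (\<lambda>g. F (act g (p i))) \<one>)"
          unfolding u_def by (rule T_interp[OF one_closed])
        have "u l (act a x) - u l x = (\<Sum>i<N. \<phi> i x *
            (T l (\<lambda>g. F (act g (p i))) a - T l (\<lambda>g. F (act g (p i))) \<one>))"
          unfolding e1 e2
          by (simp add: sum_subtractf algebra_simps)
        also have "cmod \<dots> \<le> (\<Sum>i<N. cmod (\<phi> i x) * (1 / real (Suc l)))"
        proof (rule sum_norm_le)
          fix i assume "i \<in> {..<N}"
          then have "cmod (T l (\<lambda>g. F (act g (p i))) a - T l (\<lambda>g. F (act g (p i))) \<one>) \<le> 1 / real (Suc l)"
            by (intro osc a) auto
          then show "cmod (\<phi> i x * (T l (\<lambda>g. F (act g (p i))) a - T l (\<lambda>g. F (act g (p i))) \<one>))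
              \<le> cmod (\<phi> i x) * (1 / real (Suc l))"
            unfolding norm_mult by (rule mult_left_mono) simp
        qed
        finally show ?thesis by (simp only: sum_distrib_right)
      qed
      then show "\<forall>\<^sub>F l in sequentially. norm (u (\<rho> l) (act a x) - u (\<rho> l) x)
          \<le> (\<Sum>i<N. cmod (\<phi> i x)) * (1 / real (Suc (\<rho> l)))" by (intro always_eventually allI)
      have "(\<lambda>l. 1 / real (Suc l)) \<longlonglongrightarrow> 0" by (rule LIMSEQ_Suc[OF lim_1_over_n])
      from LIMSEQ_subseq_LIMSEQ[OF this \<rho>(1)]
      show "(\<lambda>l. (\<Sum>i<N. cmod (\<phi> i x)) * (1 / real (Suc (\<rho> l)))) \<longlonglongrightarrow> 0"
        by (intro tendsto_mult_right_zero) (simp add: o_def)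
    qed
    have "(\<lambda>l. u (\<rho> l) (act a x) - u (\<rho> l) x) \<longlonglongrightarrow> P (act a x) - P x"
      by (intro tendsto_diff lim)
    from LIMSEQ_unique[OF this lim0]
    show ?thesis by simp
  qed
  show ?thesis
  proof (intro bexI[of _ P] conjI ballI allI impI inv)
    show "P \<in> fun_span B" unfolding P_def
      by (intro fun_span_sum fun_span_scale) (use \<phi> in auto)
  next
    fix D S x
    assume D: "finite D" "D \<subseteq> carrier G" and S: "closed S" "convex S"
      and FS: "\<forall>g\<in>carrier G. (\<Sum>d\<in>D. F (act g (act d x))) \<in> S"
    have "(\<lambda>l. \<Sum>d\<in>D. u (\<rho> l) (act d x)) \<longlonglongrightarrow> (\<Sum>d\<in>D. P (act d x))"
      by (intro tendsto_sum lim)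
    also have "(\<Sum>d\<in>D. P (act d x)) = of_nat (card D) * P x"
      using D inv by (simp add: subset_iff)
    finally have limD: "(\<lambda>l. \<Sum>d\<in>D. u (\<rho> l) (act d x)) \<longlonglongrightarrow> of_nat (card D) * P x" .
    have "(\<Sum>d\<in>D. u l (act d x)) \<in> S" for l
    proof -
      have "T l (\<lambda>g. \<Sum>d\<in>D. F (act g (act d x))) \<one> \<in> S"
        by (rule averaging_convex[OF T S(2)]) (use FS in auto)
      then show ?thesis
        using averaging_linear[OF T, of l "\<lambda>_. 1" "\<lambda>d g. F (act g (act d x))" D \<one>] by (simp add: u_def)
    qed
    then show "of_nat (card D) * P x \<in> S"
      by (rule closed_sequentially[OF S(1) _ limD])
  qed
qed

end

section \<open>Polynomials in finitely many coordinates\<close>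

context
  fixes e :: "nat \<Rightarrow> 'a::complex_banach" and n :: nat
begin

text \<open>Monomials are indexed by lists of variables: multiplication is \<open>@\<close> and the
  degree is the length. The set \<open>S\<close> of permitted degrees lets one argument cover
  homogeneous polynomials (\<open>{m}\<close>) and polynomials of bounded degree
  (\<open>{..N}\<close>).\<close>

definition coord_monomials :: "nat set \<Rightarrow> ('a \<Rightarrow> complex) set" where
  "coord_monomials S = (\<lambda>I x. \<Prod>i\<leftarrow>I. coords e x i) ` {I. set I \<subseteq> {..<n} \<and> length I \<in> S}"

lemma finite_coord_monomials:
  assumes "finite S"
  shows "finite (coord_monomials S)"
proof -
  have "{I. set I \<subseteq> {..<n} \<and> length I \<in> S} = (\<Union>m\<in>S. {I. set I \<subseteq> {..<n} \<and> length I = m})" by auto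
  then show ?thesis
    using assms by (simp add: coord_monomials_def finite_lists_length_eq)
qed

lemma fun_span_monomials_mono: "f \<in> fun_span (coord_monomials S) \<Longrightarrow> S \<subseteq> S' \<Longrightarrow> f \<in> fun_span (coord_monomials S')"
  by (erule fun_span_mono) (auto simp: coord_monomials_def)

lemma fun_span_monomials_const: "(\<lambda>x. c) \<in> fun_span (coord_monomials {0})"
proof -
  have "(\<lambda>x. 1) \<in> coord_monomials {0}" by (auto simp: coord_monomials_def)
  from fun_span_scaled_base[OF this, of c] show ?thesis by simp
qed

lemma fun_span_monomials_coords:
  assumes "i < n"
  shows "(\<lambda>x. coords e x i) \<in> fun_span (coord_monomials {1})"
proof -
  have "(\<lambda>x. coords e x i) \<in> coord_monomials {1}"
    unfolding coord_monomials_def by (rule image_eqI[of _ _ "[i]"]) (use assms in auto)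
  then show ?thesis by (rule fun_span_base)
qed

lemma fun_span_monomials_mult:
  assumes "f \<in> fun_span (coord_monomials S)" "g \<in> fun_span (coord_monomials S')"
    and SS: "\<And>a b. a \<in> S \<Longrightarrow> b \<in> S' \<Longrightarrow> a + b \<in> S''"
  shows "(\<lambda>x. f x * g x) \<in> fun_span (coord_monomials S'')"
  using assms(1)
proof induction
  case fun_span_zero
  show ?case by (simp add: fun_span.fun_span_zero)
next
  case (fun_span_step b f c)
  have "(\<lambda>x. b x * g x) \<in> fun_span (coord_monomials S'')"
    using assms(2)
  proof induction
    case fun_span_zero
    show ?case by (simp add: fun_span.fun_span_zero)
  next
    case (fun_span_step b' g' c')
    obtain I I' where I: "b = (\<lambda>x. \<Prod>i\<leftarrow>I. coords e x i)" "set I \<subseteq> {..<n}" "length I \<in> S"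
      "b' = (\<lambda>x. \<Prod>i\<leftarrow>I'. coords e x i)" "set I' \<subseteq> {..<n}" "length I' \<in> S'"
      using \<open>b \<in> coord_monomials S\<close> \<open>b' \<in> coord_monomials S'\<close> by (auto simp: coord_monomials_def)
    have "(\<lambda>x. b x * b' x) \<in> coord_monomials S''"
      unfolding coord_monomials_def
      by (rule image_eqI[of _ _ "I @ I'"]) (use I SS in \<open>auto simp: coord_monomials_def\<close>)
    then have "(\<lambda>x. c' * (b x * b' x) + b x * g' x) \<in> fun_span (coord_monomials S'')"
      using fun_span_step by (intro fun_span.fun_span_step)
    then show ?case by (simp add: algebra_simps)
  qed
  from fun_span_add[OF fun_span_scale[OF this, of c] fun_span_step.IH] show ?case
    by (simp add: algebra_simps)
qed

text \<open>\<open>S k\<close> collects the degrees possible in a \<open>k\<close>-th power; the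
  families used later are \<open>{..N * k}\<close> and \<open>{m * k}\<close>.\<close>

lemma fun_span_monomials_power:
  assumes f: "f \<in> fun_span (coord_monomials (S 1))" and S: "0 \<in> S 0" "\<And>k a b. a \<in> S 1 \<Longrightarrow> b \<in> S k \<Longrightarrow> a + b \<in> S (Suc k)"
  shows "(\<lambda>x. f x ^ k) \<in> fun_span (coord_monomials (S k))"
proof (induction k)
  case 0
  show ?case using fun_span_monomials_mono[OF fun_span_monomials_const, of "S 0" 1] S by simp
next
  case (Suc k)
  show ?case using fun_span_monomials_mult[OF f Suc.IH S(2)] by simp
qed

text \<open>Replacing variables by linear forms preserves the degree of a monomial. Applied to group
  elements, this confines all translates of a polynomial to one finite-dimensional space.\<close>

lemma fun_span_monomials_linear_substitution:
  assumes f: "f \<in> fun_span (coord_monomials S)"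
    and lin: "\<And>x i. i < n \<Longrightarrow> coords e (h x) i = (\<Sum>k<n. a i k * coords e x k)"
  shows "(\<lambda>x. f (h x)) \<in> fun_span (coord_monomials S)"
  using f
proof induction
  case fun_span_zero
  show ?case by (rule fun_span.fun_span_zero)
next
  case (fun_span_step b f c)
  then obtain I where I: "b = (\<lambda>x. \<Prod>i\<leftarrow>I. coords e x i)" "set I \<subseteq> {..<n}" "length I \<in> S"
    by (auto simp: coord_monomials_def)
  have "(\<lambda>x. \<Prod>i\<leftarrow>I. coords e (h x) i) \<in> fun_span (coord_monomials {length I})"
    using I(2)
  proof (induction I)
    case Nil
    show ?case using fun_span_monomials_const[of 1] by simp
  next
    case (Cons i I)
    have "(\<lambda>x. coords e (h x) i) = (\<lambda>x. \<Sum>k<n. a i k * coords e x k)"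
      using Cons.prems lin by auto
    moreover have "\<dots> \<in> fun_span (coord_monomials {1})"
      by (intro fun_span_sum fun_span_scale fun_span_monomials_coords) simp
    ultimately have "(\<lambda>x. coords e (h x) i) \<in> fun_span (coord_monomials {1})" by simp
    then have "(\<lambda>x. coords e (h x) i * (\<Prod>i\<leftarrow>I. coords e (h x) i)) \<in> fun_span (coord_monomials {length (i # I)})"
      by (rule fun_span_monomials_mult) (use Cons in auto)
    then show ?case by simp
  qed
  then have "(\<lambda>x. b (h x)) \<in> fun_span (coord_monomials S)"
    using I by (auto intro: fun_span_monomials_mono)
  from fun_span_add[OF fun_span_scale[OF this] fun_span_step.IH] show ?case .
qed

section \<open>Polynomials composed with the projection onto the first \<open>n\<close> basis
  vectors\<close>

lemma multilinear_formD:
  fixes A :: "(nat \<Rightarrow> 'a) \<Rightarrow> complex"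
  assumes "multilinear_form m A"
  shows "(\<And>i. i < m \<Longrightarrow> x i = x' i) \<Longrightarrow> A x = A x'"
    and "i < m \<Longrightarrow> A (x(i := y + z)) = A (x(i := y)) + A (x(i := z))"
    and "i < m \<Longrightarrow> A (x(i := c *\<^sub>C y)) = c * A (x(i := y))"
  using assms unfolding multilinear_form_def Vector_Spaces.linear_iff by blast+

lemma multilinear_form_sum:
  fixes A :: "(nat \<Rightarrow> 'a) \<Rightarrow> complex"
  assumes A: "multilinear_form m A" and i: "i < m"
  shows "A (x(i := (\<Sum>k\<in>J. c k *\<^sub>C v k))) = (\<Sum>k\<in>J. c k * A (x(i := v k)))"
proof -
  have zero: "A (x(i := 0)) = 0" using multilinear_formD(3)[OF A i, of x 0 0] by simp
  show ?thesis
    by (induction J rule: infinite_finite_induct)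
      (simp_all only: sum.infinite sum.empty sum.insert not_False_eq_True zero multilinear_formD(2,3)[OF A i])
qed

text \<open>The arguments are expanded one at a time. The fixed arguments \<open>y\<close> stay
  arbitrary in the induction because each expansion puts a basis vector \<open>e k\<close> among
  them.\<close>

lemma multilinear_form_basis_proj:
  fixes A :: "(nat \<Rightarrow> 'a) \<Rightarrow> complex"
  assumes A: "multilinear_form m A" and "l \<le> m"
  shows "(\<lambda>x. A (\<lambda>i. if i < l then basis_proj e n x else y i)) \<in> fun_span (coord_monomials {l})"
  using assms(2)
proof (induction l arbitrary: y)
  case 0
  show ?case using fun_span_monomials_const by simp
next
  case (Suc l)
  have upd: "(\<lambda>i. if i < Suc l then basis_proj e n x else y i)
      = (\<lambda>i. if i < l then basis_proj e n x else y i)(l := \<Sum>k<n. coords e x k *\<^sub>C e k)" for x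
    by (auto simp: basis_proj_def fun_eq_iff less_Suc_eq)
  have upd': "(\<lambda>i. if i < l then w else y i)(l := v) = (\<lambda>i. if i < l then w else (y(l := v)) i)" for v w
    by (auto simp: fun_eq_iff)
  have "A (\<lambda>i. if i < Suc l then basis_proj e n x else y i)
      = (\<Sum>k<n. coords e x k * A (\<lambda>i. if i < l then basis_proj e n x else (y(l := e k)) i))" for x
    unfolding upd using Suc.prems by (subst multilinear_form_sum[OF A]) (simp_all only: upd' Suc_le_eq)
  moreover have "(\<lambda>x. \<Sum>k<n. coords e x k * A (\<lambda>i. if i < l then basis_proj e n x else (y(l := e k)) i))
      \<in> fun_span (coord_monomials {Suc l})"
    by (intro fun_span_sum fun_span_monomials_mult[OF fun_span_monomials_coords Suc.IH]) (use Suc.prems in auto)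
  ultimately show ?case by simp
qed

lemma homogeneous_polynomial_basis_proj:
  assumes "homogeneous_polynomial_of_degree m Q"
  shows "(\<lambda>x. Q (basis_proj e n x)) \<in> fun_span (coord_monomials {m})"
proof -
  obtain A where A: "multilinear_form m A" "Q = (\<lambda>x. A (\<lambda>_. x))"
    using assms by (auto simp: homogeneous_polynomial_of_degree_def)
  have "A (\<lambda>_. basis_proj e n x) = A (\<lambda>i. if i < m then basis_proj e n x else 0)" for x
    by (rule multilinear_formD(1)[OF A(1)]) simp
  then show ?thesis using multilinear_form_basis_proj[OF A(1) order_refl, of "\<lambda>_. 0"] by (simp add: A(2))
qed

lemma continuous_polynomial_basis_proj:
  assumes "continuous_polynomial Q"
  obtains N where "(\<lambda>x. Q (basis_proj e n x)) \<in> fun_span (coord_monomials {..N})"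
proof -
  obtain N p where p: "\<forall>m\<le>N. homogeneous_polynomial_of_degree m (p m)" "Q = (\<lambda>x. \<Sum>m\<le>N. p m x)"
    using assms by (auto simp: continuous_polynomial_def)
  have "(\<lambda>x. \<Sum>m\<le>N. p m (basis_proj e n x)) \<in> fun_span (coord_monomials {..N})"
    by (intro fun_span_sum fun_span_monomials_mono[OF homogeneous_polynomial_basis_proj]) (use p in auto)
  then show ?thesis using that p by simp
qed

lemma homogeneous_polynomial_add:
  assumes "homogeneous_polynomial_of_degree m f" "homogeneous_polynomial_of_degree m (g :: 'a \<Rightarrow> complex)"
  shows "homogeneous_polynomial_of_degree m (\<lambda>x. c * f x + g x)"
proof -
  obtain A B where A: "multilinear_form m A" "f = (\<lambda>x. A (\<lambda>_. x))"
    and B: "multilinear_form m B" "g = (\<lambda>x. B (\<lambda>_. x))"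
    using assms by (auto simp: homogeneous_polynomial_of_degree_def)
  have "multilinear_form m (\<lambda>x. c * A x + B x)"
    using A(1) B(1) unfolding multilinear_form_def Vector_Spaces.linear_iff
    by (auto simp: algebra_simps) metis
  then show ?thesis using A B by (auto simp: homogeneous_polynomial_of_degree_def)
qed

lemma homogeneous_polynomial_zero: "homogeneous_polynomial_of_degree m (\<lambda>x::'a. 0)"
proof -
  have "vector_space ((*) :: complex \<Rightarrow> complex \<Rightarrow> complex)"
    by unfold_locales (simp_all add: algebra_simps)
  then have "multilinear_form m (\<lambda>x :: nat \<Rightarrow> 'a. 0)"
    by (simp add: multilinear_form_def Vector_Spaces.linear_iff vector_space_scaleC)
  then show ?thesis by (auto simp: homogeneous_polynomial_of_degree_def)
qed

section \<open>Spans of monomials as continuous polynomials\<close>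

context
  assumes basis: "schauder_basis e"
begin

text \<open>The form reads the \<open>l\<close>-th variable of the list from its \<open>l\<close>-th
  argument; on the diagonal it becomes the monomial.\<close>

lemma homogeneous_polynomial_monomial:
  assumes "b \<in> coord_monomials {m}"
  shows "homogeneous_polynomial_of_degree m b"
proof -
  obtain I where I: "b = (\<lambda>x. \<Prod>i\<leftarrow>I. coords e x i)" "length I = m"
    using assms by (auto simp: coord_monomials_def)
  have vs: "vector_space ((*) :: complex \<Rightarrow> complex \<Rightarrow> complex)"
    by unfold_locales (simp_all add: algebra_simps)
  have upd: "(\<Prod>l<m. coords e ((x(i := y)) l) (I ! l)) = coords e y (I ! i) * (\<Prod>l\<in>{..<m} - {i}. coords e (x l) (I ! l))"
    if "i < m" for x i y
  proof -
    have "(\<Prod>l<m. coords e ((x(i := y)) l) (I ! l))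
        = coords e ((x(i := y)) i) (I ! i) * (\<Prod>l\<in>{..<m} - {i}. coords e ((x(i := y)) l) (I ! l))"
      by (rule prod.remove) (use that in auto)
    also have "(\<Prod>l\<in>{..<m} - {i}. coords e ((x(i := y)) l) (I ! l)) = (\<Prod>l\<in>{..<m} - {i}. coords e (x l) (I ! l))"
      by (rule prod.cong) auto
    finally show ?thesis by simp
  qed
  have "multilinear_form m (\<lambda>x. \<Prod>l<m. coords e (x l) (I ! l))"
    unfolding multilinear_form_def Vector_Spaces.linear_iff
  proof (intro conjI allI impI vs vector_space_scaleC)
    fix x y :: "nat \<Rightarrow> 'a" assume "\<forall>i<m. x i = y i"
    then show "(\<Prod>l<m. coords e (x l) (I ! l)) = (\<Prod>l<m. coords e (y l) (I ! l))"
      by (intro prod.cong) auto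
  qed (simp_all only: upd coords_add[OF basis] coords_scaleC[OF basis] distrib_right mult.assoc)
  moreover have "b x = (\<Prod>l<m. coords e x (I ! l))" for x
    by (simp add: I prod.list_conv_set_nth atLeast0LessThan)
  ultimately show ?thesis unfolding homogeneous_polynomial_of_degree_def by blast
qed

lemma fun_span_monomials_homogeneous:
  "f \<in> fun_span (coord_monomials {m}) \<Longrightarrow> homogeneous_polynomial_of_degree m f"
  by (induction rule: fun_span.induct)
    (auto intro: homogeneous_polynomial_zero homogeneous_polynomial_add homogeneous_polynomial_monomial)

lemma fun_span_monomials_continuous:
  "f \<in> fun_span (coord_monomials S) \<Longrightarrow> continuous_on UNIV f"
proof (induction rule: fun_span.induct)
  case (fun_span_step b f c)
  then obtain I where I: "b = (\<lambda>x. \<Prod>i\<leftarrow>I. coords e x i)" by (auto simp: coord_monomials_def)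
  have "continuous_on UNIV b" unfolding I
    by (induction I) (auto intro!: continuous_intros continuous_coords[OF basis])
  then show ?case using fun_span_step by (intro continuous_intros)
qed auto

lemma fun_span_monomials_polynomial:
  assumes "f \<in> fun_span (coord_monomials {..N})"
  shows "continuous_polynomial f"
proof -
  have "\<exists>p. (\<forall>m\<le>N. homogeneous_polynomial_of_degree m (p m)) \<and> f = (\<lambda>x. \<Sum>m\<le>N. p m x)"
    using assms
  proof induction
    case fun_span_zero
    show ?case by (intro exI[of _ "\<lambda>m x. 0"]) (auto intro: homogeneous_polynomial_zero)
  next
    case (fun_span_step b f c)
    then obtain p where p: "\<forall>m\<le>N. homogeneous_polynomial_of_degree m (p m)" "f = (\<lambda>x. \<Sum>m\<le>N. p m x)" by blast
    obtain k where k: "k \<le> N" "b \<in> coord_monomials {k}"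
      using fun_span_step.hyps(1) by (auto simp: coord_monomials_def)
    have "(\<Sum>m\<le>N. (p(k := \<lambda>x. c * b x + p k x)) m x) = c * b x + f x" for x
    proof -
      have "(\<Sum>m\<le>N. (p(k := \<lambda>x. c * b x + p k x)) m x) = (\<Sum>m\<le>N. (if m = k then c * b x else 0) + p m x)"
        by (intro sum.cong) auto
      then show ?thesis using k by (simp add: sum.distrib p)
    qed
    moreover have "\<forall>m\<le>N. homogeneous_polynomial_of_degree m ((p(k := \<lambda>x. c * b x + p k x)) m)"
      using p k by (auto intro: homogeneous_polynomial_add homogeneous_polynomial_monomial)
    ultimately show ?case by (intro exI[of _ "p(k := \<lambda>x. c * b x + p k x)"]) auto
  qed
  then show ?thesis
    using fun_span_monomials_continuous[OF assms] by (auto simp: continuous_polynomial_def)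
qed

end
end

section \<open>Operator groups with compact compressions\<close>

text \<open>Recurrence on a torus: along a common convergent subsequence, late powers of every
  \<open>u\<close> are close to each other. Dividing by a power of modulus one shows that the
  difference \<open>k\<close> of two exponents brings all \<open>u ^ k\<close> near 1, and exponents
  far apart in the subsequence make \<open>k\<close> as large as desired.\<close>

lemma powers_near_one:
  assumes "finite U" "\<And>u. u \<in> U \<Longrightarrow> cmod u = 1"
  shows "\<exists>k\<ge>k0. \<forall>u\<in>U. Re (u ^ k) \<ge> 1 / 2"
proof -
  have "\<exists>\<rho>. strict_mono (\<rho> :: nat \<Rightarrow> nat) \<and> (\<forall>u\<in>U. convergent (\<lambda>l. u ^ \<rho> l))"
    by (rule finite_common_convergent_subsequence[OF assms(1)])
      (auto simp: bounded_iff norm_power assms(2) intro!: exI[of _ 1])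
  then obtain \<rho> :: "nat \<Rightarrow> nat" where \<rho>: "strict_mono \<rho>" "\<forall>u\<in>U. convergent (\<lambda>l. u ^ \<rho> l)" by blast
  have "\<forall>\<^sub>F a in sequentially. \<forall>u\<in>U. \<forall>b\<ge>a. cmod (u ^ \<rho> b - u ^ \<rho> a) < 1 / 2"
  proof (intro eventually_ball_finite assms(1) ballI)
    fix u assume "u \<in> U"
    then have "Cauchy (\<lambda>l. u ^ \<rho> l)" using \<rho>(2) by (simp add: convergent_Cauchy)
    then obtain N where "\<And>a b. a \<ge> N \<Longrightarrow> b \<ge> N \<Longrightarrow> dist (u ^ \<rho> a) (u ^ \<rho> b) < 1 / 2"
      by (meson metric_CauchyD half_gt_zero zero_less_one)
    then show "\<forall>\<^sub>F a in sequentially. \<forall>b\<ge>a. cmod (u ^ \<rho> b - u ^ \<rho> a) < 1 / 2"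
      unfolding eventually_sequentially by (metis dist_norm order_trans)
  qed
  then obtain a where a: "\<And>u b. u \<in> U \<Longrightarrow> b \<ge> a \<Longrightarrow> cmod (u ^ \<rho> b - u ^ \<rho> a) < 1 / 2"
    by (auto simp: eventually_sequentially)
  define k where "k = \<rho> (a + k0) - \<rho> a"
  have "\<rho> a + k0 \<le> \<rho> (a + k0)"
  proof (induction k0)
    case (Suc k0)
    have "\<rho> (a + k0) < \<rho> (a + Suc k0)" using \<rho>(1) by (simp add: strict_mono_def)
    then show ?case using Suc by simp
  qed simp
  then have k: "k \<ge> k0" "\<rho> (a + k0) = \<rho> a + k" by (auto simp: k_def)
  have "Re (u ^ k) \<ge> 1 / 2" if u: "u \<in> U" for u
  proof -
    have "u ^ \<rho> (a + k0) - u ^ \<rho> a = u ^ \<rho> a * (u ^ k - 1)"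
      by (simp add: k power_add algebra_simps)
    then have "cmod (u ^ k - 1) < 1 / 2"
      using a[OF u, of "a + k0"] assms(2)[OF u] by (simp add: norm_mult norm_power)
    then show ?thesis using abs_Re_le_cmod[of "u ^ k - 1"] by simp
  qed
  with k show ?thesis by blast
qed

lemma Re_power_Arg2pi:
  assumes "Re (cis (Arg2pi v) ^ k) \<ge> 1 / 2"
  shows "Re (v ^ k) \<ge> cmod v ^ k / 2"
proof -
  have "v = complex_of_real (cmod v) * cis (Arg2pi v)"
    using Arg2pi_eq[of v] by (simp add: cis_conv_exp)
  then have "v ^ k = complex_of_real (cmod v ^ k) * cis (Arg2pi v) ^ k"
    by (metis of_real_power power_mult_distrib)
  then have "Re (v ^ k) = cmod v ^ k * Re (cis (Arg2pi v) ^ k)" by simp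
  moreover have "cmod v ^ k * Re (cis (Arg2pi v) ^ k) \<ge> cmod v ^ k * (1 / 2)"
    by (rule mult_left_mono[OF assms]) simp
  ultimately show ?thesis by simp
qed

text \<open>Unit vectors lie in the unit ball, so closeness of compressions in operator norm gives
  closeness of all matrix entries.\<close>

lemma LCn_entry_le:
  assumes "S \<in> LCn n" "T \<in> LCn n" "k < n" "i < n"
  shows "cmod (S (\<lambda>l. if l = k then 1 else 0) i - T (\<lambda>l. if l = k then 1 else 0) i) \<le> LCn_dist n S T"
proof -
  let ?u = "\<lambda>l. if l = k then 1 else 0 :: complex"
  have "Cn_norm n ?u \<le> (\<Sum>i<n. cmod (?u i))"
    unfolding Cn_norm_def by (rule L2_set_le_sum) simp
  also have "\<dots> = (\<Sum>i<n. if i = k then 1 else 0)" by (rule sum.cong) auto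
  also have "\<dots> = 1" using assms by simp
  finally have "Cn_norm n (\<lambda>i. S ?u i - T ?u i) \<le> LCn_dist n S T"
    using assms by (intro LCn_dist_upper) (auto simp: Cn_def)
  moreover have "cmod (S ?u i - T ?u i) \<le> Cn_norm n (\<lambda>i. S ?u i - T ?u i)"
    unfolding Cn_norm_def
    by (rule member_le_L2_set[of "{..<n}" i "\<lambda>i. cmod (S ?u i - T ?u i)"]) (use assms in auto)
  ultimately show ?thesis by (rule order_trans[rotated])
qed

context
  fixes e :: "nat \<Rightarrow> 'a::complex_banach"
  assumes basis: "schauder_basis e"
begin

lemma basis_embed_coord_map: "basis_embed e n (coord_map e n x) = basis_proj e n x"
  by (simp add: basis_embed_def coord_map_def Cn_id_def basis_proj_def)

lemma compression_entry:
  assumes "k < n" "i < n"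
  shows "(coord_map e n \<circ> g \<circ> basis_embed e n) (\<lambda>l. if l = k then 1 else 0) i = coords e (g (e k)) i"
proof -
  have "basis_embed e n (\<lambda>l. if l = k then 1 else 0) = (\<Sum>l<n. if l = k then e l else 0)"
    unfolding basis_embed_def by (rule sum.cong) (auto simp: scaleC_one)
  then show ?thesis using assms by (simp add: coord_map_def Cn_id_def)
qed

lemma coords_span_tail:
  assumes "x \<in> module.span (*\<^sub>C) {e i | i. n \<le> i}" "k < n"
  shows "coords e x k = 0"
  using assms(1)
proof (induction rule: scaleC.span_induct_alt)
  case base
  show ?case by (simp add: coords_zero[OF basis])
next
  case (step c y x)
  then show ?case using assms(2)
    by (auto simp: coords_add[OF basis] coords_scaleC[OF basis] coords_basis[OF basis])
qed

text \<open>For \<open>n \<le> k\<close> the image of \<open>e k\<close> stays in the tail span and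
  contributes nothing to coordinate \<open>i\<close>. Continuity of \<open>g\<close> and of the
  coordinate extends this from partial sums to \<open>x\<close>.\<close>

lemma coords_operator:
  assumes g: "g \<in> operators"
    and tail: "g ` module.span (*\<^sub>C) {e i | i. n \<le> i} \<subseteq> module.span (*\<^sub>C) {e i | i. n \<le> i}"
    and i: "i < n"
  shows "coords e (g x) i = (\<Sum>k<n. coords e (g (e k)) i * coords e x k)"
proof -
  have lin: "g (y + z) = g y + g z" "g (c *\<^sub>C y) = c *\<^sub>C g y" for y z c
    using g by (auto simp: operators_def Vector_Spaces.linear_iff)
  have g0: "g 0 = 0" using lin(2)[of 0 0] by simp
  have gsum: "g (sum f A) = (\<Sum>a\<in>A. g (f a))" for f and A :: "nat set"
    by (induction A rule: infinite_finite_induct) (simp_all add: lin g0)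
  define a where "a k = coords e (g (e k)) i * coords e x k" for k
  have fin: "coords e (g (basis_proj e N x)) i = (\<Sum>k<N. a k)" for N
    by (simp add: basis_proj_def gsum lin coords_sum[OF basis] coords_scaleC[OF basis] a_def mult.commute)
  have a0: "a k = 0" if "n \<le> k" for k
  proof -
    have "e k \<in> module.span (*\<^sub>C) {e i | i. n \<le> i}" by (rule scaleC.span_base) (use that in auto)
    then have "g (e k) \<in> module.span (*\<^sub>C) {e i | i. n \<le> i}" using tail by blast
    then show ?thesis using coords_span_tail[OF _ i] by (simp add: a_def)
  qed
  have "continuous_on UNIV (\<lambda>y. coords e (g y) i)"
    using g continuous_on_compose2[OF continuous_coords[OF basis], of UNIV g i]
    by (auto simp: operators_def)
  then have "(\<lambda>N. coords e (g (basis_proj e N x)) i) \<longlonglongrightarrow> coords e (g x) i"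
    using basis_proj_tendsto[OF basis, of x]
    by (auto simp: continuous_on_eq_continuous_at intro: isCont_tendsto_compose)
  then have "a sums coords e (g x) i" by (simp add: sums_def fin)
  moreover have "a sums (\<Sum>k<n. a k)" by (rule sums_finite) (use a0 in auto)
  ultimately show ?thesis by (simp add: sums_unique2 a_def)
qed

section \<open>Almost periodicity and averages for a group with compact compression\<close>

context
  fixes G :: "('a \<Rightarrow> 'a) set" and n :: nat
  assumes grp: "group (comp_monoid G)" and ops: "G \<subseteq> operators"
    and compact: "compactin (LCn_topology n) (compressions e G n)"
    and tail: "\<And>g. g \<in> G \<Longrightarrow>
      g ` module.span (*\<^sub>C) {e i | i. n \<le> i} \<subseteq> module.span (*\<^sub>C) {e i | i. n \<le> i}"
begin

interpretation group "comp_monoid G" by (rule grp)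

lemma coords_group:
  assumes "g \<in> G" "i < n"
  shows "coords e (g x) i = (\<Sum>k<n. coords e (g (e k)) i * coords e x k)"
  using assms ops tail by (intro coords_operator) auto

lemma compressions_in_LCn: "g \<in> G \<Longrightarrow> coord_map e n \<circ> g \<circ> basis_embed e n \<in> LCn n"
  using compactin_subset_topspace[OF compact]
  by (auto simp: compressions_def LCn_topology_def Metric_space.topspace_mtopology[OF LCn_Metric_space])

text \<open>Each \<open>g\<close> is labelled by the centre of a ball of radius \<epsilon>/2
  containing its compression; finitely many balls suffice by compactness.\<close>

lemma entries_totally_bounded:
  assumes "\<epsilon> > 0"
  shows "\<exists>c :: ('a \<Rightarrow> 'a) \<Rightarrow> nat. finite (c ` G) \<and> (\<forall>g\<in>G. \<forall>h\<in>G. c g = c h \<longrightarrow>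
    (\<forall>k<n. \<forall>i<n. cmod (coords e (g (e k)) i - coords e (h (e k)) i) \<le> \<epsilon>))"
proof -
  interpret M: Metric_space "LCn n" "LCn_dist n" by (rule LCn_Metric_space)
  let ?T = "\<lambda>g. coord_map e n \<circ> g \<circ> basis_embed e n"
  have "M.mtotally_bounded (compressions e G n)"
    using compact M.compactin_imp_mtotally_bounded by (simp add: LCn_topology_def)
  then obtain C where C: "finite C" "compressions e G n \<subseteq> (\<Union>x\<in>C. M.mball x (\<epsilon> / 2))"
    unfolding M.mtotally_bounded_def using assms by (meson half_gt_zero)
  obtain f :: "_ \<Rightarrow> nat" where f: "inj_on f C"
    using finite_imp_inj_to_nat_seg[OF C(1)] by blast
  have "\<forall>g\<in>G. \<exists>x\<in>C. ?T g \<in> M.mball x (\<epsilon> / 2)"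
  proof
    fix g assume "g \<in> G"
    then have "?T g \<in> compressions e G n" by (auto simp: compressions_def)
    then show "\<exists>x\<in>C. ?T g \<in> M.mball x (\<epsilon> / 2)" using C(2) by blast
  qed
  then obtain x where x: "\<And>g. g \<in> G \<Longrightarrow> x g \<in> C \<and> ?T g \<in> M.mball (x g) (\<epsilon> / 2)" by metis
  show ?thesis
  proof (intro exI[of _ "\<lambda>g. f (x g)"] conjI ballI allI impI)
    have "(\<lambda>g. f (x g)) ` G \<subseteq> f ` C" using x by blast
    then show "finite ((\<lambda>g. f (x g)) ` G)" by (rule finite_subset) (use C in simp)
    fix g h k i assume gh: "g \<in> G" "h \<in> G" "f (x g) = f (x h)" and ki: "k < n" "i < n"
    have "x g = x h" using gh f x by (auto dest: inj_onD)
    then have "LCn_dist n (?T g) (?T h) < \<epsilon>"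
      using x[OF gh(1)] x[OF gh(2)] M.triangle[of "?T g" "x g" "?T h"] M.commute[of "?T g" "x g"] by auto
    moreover have "cmod (?T g (\<lambda>l. if l = k then 1 else 0) i - ?T h (\<lambda>l. if l = k then 1 else 0) i)
        \<le> LCn_dist n (?T g) (?T h)"
      by (intro LCn_entry_le compressions_in_LCn gh ki)
    ultimately show "cmod (coords e (g (e k)) i - coords e (h (e k)) i) \<le> \<epsilon>"
      unfolding compression_entry[OF ki] by linarith
  qed
qed

lemma entries_bounded:
  obtains C where "C > 0" "\<And>g k i. \<lbrakk>g \<in> G; k < n; i < n\<rbrakk> \<Longrightarrow> cmod (coords e (g (e k)) i) \<le> C"
proof -
  obtain c :: "('a \<Rightarrow> 'a) \<Rightarrow> nat" where c: "finite (c ` G)" "\<forall>g\<in>G. \<forall>h\<in>G. c g = c h \<longrightarrow>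
    (\<forall>k<n. \<forall>i<n. cmod (coords e (g (e k)) i - coords e (h (e k)) i) \<le> 1)"
    using entries_totally_bounded[of 1] by auto
  define D where "D = inv_into G c ` c ` G"
  define C where "C = 1 + (\<Sum>d\<in>D. \<Sum>k<n. \<Sum>i<n. cmod (coords e (d (e k)) i))"
  have D: "finite D" using c(1) by (simp add: D_def)
  show ?thesis
  proof (rule that[of C])
    show "C > 0" unfolding C_def by (intro add_pos_nonneg sum_nonneg) auto
    fix g k i assume g: "g \<in> G" and ki: "k < n" "i < n"
    define d where "d = inv_into G c (c g)"
    have d: "d \<in> D" "d \<in> G" "c g = c d" using g by (auto simp: d_def D_def inv_into_into f_inv_into_f)
    have "cmod (coords e (d (e k)) i) \<le> (\<Sum>i<n. cmod (coords e (d (e k)) i))"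
      by (rule member_le_sum) (use ki in auto)
    also have "\<dots> \<le> (\<Sum>k<n. \<Sum>i<n. cmod (coords e (d (e k)) i))"
      by (rule member_le_sum[of k "{..<n}" "\<lambda>k. \<Sum>i<n. cmod (coords e (d (e k)) i)"]) (use ki in \<open>auto intro: sum_nonneg\<close>)
    also have "\<dots> \<le> (\<Sum>d\<in>D. \<Sum>k<n. \<Sum>i<n. cmod (coords e (d (e k)) i))"
      by (rule member_le_sum[of d D "\<lambda>d. \<Sum>k<n. \<Sum>i<n. cmod (coords e (d (e k)) i)"])
        (use d D in \<open>auto intro!: sum_nonneg\<close>)
    finally have "cmod (coords e (d (e k)) i) \<le> C - 1" by (simp add: C_def)
    moreover have "cmod (coords e (g (e k)) i - coords e (d (e k)) i) \<le> 1"
      using c(2) g d ki by blast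
    ultimately show "cmod (coords e (g (e k)) i) \<le> C"
      using norm_triangle_sub[of "coords e (g (e k)) i" "coords e (d (e k)) i"] by linarith
  qed
qed

text \<open>The matrix of \<open>a \<circ> g\<close> is the product of the matrices of
  \<open>a\<close> and \<open>g\<close>. Entries of the left factor are bounded uniformly, so
  closeness of \<open>g\<close> and \<open>h\<close> survives composition with any
  \<open>a\<close>.\<close>

lemma almost_periodic_coords:
  assumes i: "i < n"
  shows "almost_periodic (\<lambda>g. coords e (g x) i)"
  unfolding almost_periodic_def
proof (intro allI impI)
  fix \<epsilon> :: real assume \<epsilon>: "\<epsilon> > 0"
  obtain C where C: "C > 0" "\<And>g k i. \<lbrakk>g \<in> G; k < n; i < n\<rbrakk> \<Longrightarrow> cmod (coords e (g (e k)) i) \<le> C"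
    using entries_bounded by metis
  define X where "X = 1 + (\<Sum>k<n. cmod (coords e x k))"
  have X: "X > 0" unfolding X_def by (intro add_pos_nonneg sum_nonneg) auto
  have n: "real n > 0" using i by simp
  \<comment> \<open>Applying matrices to \<open>x\<close> costs a factor \<open>X\<close>; composing
    with \<open>a\<close> sums \<open>n\<close> terms with entries of size at most
    \<open>C\<close>.\<close>
  define \<delta> where "\<delta> = \<epsilon> / (real n * C * X)"
  have \<delta>: "\<delta> > 0" using \<epsilon> C X n by (simp add: \<delta>_def)
  from entries_totally_bounded[OF \<delta>] obtain c :: "('a \<Rightarrow> 'a) \<Rightarrow> nat" where c: "finite (c ` G)"
    "\<forall>g\<in>G. \<forall>h\<in>G. c g = c h \<longrightarrow> (\<forall>k<n. \<forall>i<n. cmod (coords e (g (e k)) i - coords e (h (e k)) i) \<le> \<delta>)"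
    by blast
  have le: "cmod (coords e (a (g x)) i - coords e (a (h x)) i) \<le> \<epsilon>"
    if a: "a \<in> G" "g \<in> G" "h \<in> G" and gh: "c g = c h" for a g h
  proof -
    have gh_le: "cmod (coords e (g x) l - coords e (h x) l) \<le> \<delta> * X" if l: "l < n" for l
    proof -
      have "coords e (g x) l - coords e (h x) l
          = (\<Sum>k<n. (coords e (g (e k)) l - coords e (h (e k)) l) * coords e x k)"
        unfolding coords_group[OF a(2) l, of x] coords_group[OF a(3) l, of x]
        by (simp add: left_diff_distrib sum_subtractf)
      also have "cmod \<dots> \<le> (\<Sum>k<n. \<delta> * cmod (coords e x k))"
      proof (rule sum_norm_le)
        fix k assume "k \<in> {..<n}"
        then have "cmod (coords e (g (e k)) l - coords e (h (e k)) l) \<le> \<delta>" using c(2) a gh l by blast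
        then show "cmod ((coords e (g (e k)) l - coords e (h (e k)) l) * coords e x k) \<le> \<delta> * cmod (coords e x k)"
          unfolding norm_mult by (rule mult_right_mono) simp
      qed
      also have "\<dots> \<le> \<delta> * X" using \<delta> by (simp add: X_def flip: sum_distrib_left)
      finally show ?thesis .
    qed
    have "coords e (a (g x)) i - coords e (a (h x)) i
        = (\<Sum>l<n. coords e (a (e l)) i * (coords e (g x) l - coords e (h x) l))"
      unfolding coords_group[OF a(1) i, of "g x"] coords_group[OF a(1) i, of "h x"]
      by (simp add: right_diff_distrib sum_subtractf)
    also have "cmod \<dots> \<le> (\<Sum>l<n. C * (\<delta> * X))"
    proof (rule sum_norm_le)
      fix l assume "l \<in> {..<n}"
      then have l: "l < n" by simp
      show "cmod (coords e (a (e l)) i * (coords e (g x) l - coords e (h x) l)) \<le> C * (\<delta> * X)"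
        unfolding norm_mult using C(1) by (intro mult_mono C(2) a l i gh_le) auto
    qed
    also have "\<dots> = \<delta> * (real n * C * X)" by simp
    also have "\<dots> = \<epsilon>" using C X n by (simp add: \<delta>_def)
    finally show ?thesis .
  qed
  show "\<exists>c :: ('a \<Rightarrow> 'a) \<Rightarrow> nat. finite (c ` carrier (comp_monoid G)) \<and>
      (\<forall>g\<in>carrier (comp_monoid G). \<forall>h\<in>carrier (comp_monoid G). c g = c h \<longrightarrow>
        (\<forall>a\<in>carrier (comp_monoid G). cmod (coords e ((a \<otimes>\<^bsub>comp_monoid G\<^esub> g) x) i
          - coords e ((a \<otimes>\<^bsub>comp_monoid G\<^esub> h) x) i) \<le> \<epsilon>))"
    using c(1) le by (intro exI[of _ c]) auto
qed

lemma almost_periodic_polynomial: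
  assumes "f \<in> fun_span (coord_monomials e n S)"
  shows "almost_periodic (\<lambda>g. f (g x))"
  using assms
proof induction
  case fun_span_zero
  show ?case by (rule almost_periodic_const)
next
  case (fun_span_step b f c)
  then obtain I where I: "b = (\<lambda>x. \<Prod>i\<leftarrow>I. coords e x i)" "set I \<subseteq> {..<n}"
    by (auto simp: coord_monomials_def)
  have "almost_periodic (\<lambda>g. \<Prod>i\<leftarrow>I. coords e (g x) i)"
    using I(2) by (induction I) (simp_all add: almost_periodic_const almost_periodic_mult almost_periodic_coords)
  then show ?case unfolding I(1)
    by (intro almost_periodic_add almost_periodic_mult[OF almost_periodic_const] fun_span_step.IH)
qed

text \<open>The clause on \<open>D\<close> transfers bounds to the average, whose values at all
  \<open>d x\<close> coincide. \<open>D = {id}\<close> with a disc serves for points of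
  \<open>K\<close>; at \<open>z\<close> single values may be small, and only sums over a suitable
  \<open>D\<close> lie in a half-plane away from 0.\<close>

lemma polynomial_average:
  assumes R: "R \<in> fun_span (coord_monomials e n S)" and S: "finite S"
  shows "\<exists>P\<in>fun_span (coord_monomials e n S). invariant_fun G P \<and>
    (\<forall>D C x. finite D \<longrightarrow> D \<subseteq> G \<longrightarrow> closed C \<longrightarrow> convex C \<longrightarrow>
      (\<forall>g\<in>G. (\<Sum>d\<in>D. R (g (d x))) \<in> C) \<longrightarrow> of_nat (card D) * P x \<in> C)"
proof -
  have "(\<lambda>x. R (g x)) \<in> fun_span (coord_monomials e n S)" if "g \<in> G" for g
    by (rule fun_span_monomials_linear_substitution[OF R coords_group[OF that]])
  then have "\<exists>P\<in>fun_span (coord_monomials e n S). (\<forall>g\<in>carrier (comp_monoid G). \<forall>x. P (g x) = P x) \<and>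
    (\<forall>D C x. finite D \<longrightarrow> D \<subseteq> carrier (comp_monoid G) \<longrightarrow> closed C \<longrightarrow> convex C \<longrightarrow>
      (\<forall>g\<in>carrier (comp_monoid G). (\<Sum>d\<in>D. R (g (d x))) \<in> C) \<longrightarrow> of_nat (card D) * P x \<in> C)"
    by (intro invariant_average finite_coord_monomials S almost_periodic_polynomial[OF R]) simp_all
  then show ?thesis by (simp only: partial_object.simps invariant_fun_def)
qed

text \<open>The average of \<open>q ^ k\<close> is bounded below at \<open>z\<close> as follows.  For suitable large \<open>k\<close>, all values of
  \<open>q ^ k\<close> on the orbit of \<open>z\<close> have real part at least \<open>- r ^ k\<close>.  As \<open>g \<mapsto> q (g z)\<close> is almost
  periodic, there is a finite set \<open>D\<close> such that every \<open>g \<in> G\<close> maps one of the points \<open>d z\<close> with \<open>d \<in> D\<close>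
  to a point where \<open>\<bar>q\<bar> \<ge> t\<close>; and the average takes the same value at all these points.\<close>

lemma separating_average:
  assumes q: "q \<in> fun_span (coord_monomials e n (S 1))"
    and S: "\<And>k. finite (S k)" "0 \<in> S 0" "\<And>k a b. a \<in> S 1 \<Longrightarrow> b \<in> S k \<Longrightarrow> a + b \<in> S (Suc k)"
    and s: "0 \<le> s" "s < t" and r: "0 < r" "r < t" and t: "t < cmod (q z)"
    and K: "\<And>w g. w \<in> K \<Longrightarrow> g \<in> G \<Longrightarrow> cmod (q (g w)) \<le> s"
    and args: "finite {Arg2pi (q (g z)) | g. r \<le> cmod (q (g z)) \<and> g \<in> G}"
  shows "\<exists>k. \<exists>P\<in>fun_span (coord_monomials e n (S k)). invariant_fun G P \<and>
    (\<forall>w\<in>K. cmod (P w) \<le> s ^ k) \<and> s ^ k < cmod (P z)"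
proof -
  have id: "id \<in> G" using one_closed by simp
  obtain D where D: "finite D" "D \<subseteq> G" "D \<noteq> {}"
    and net: "\<And>g. g \<in> G \<Longrightarrow> \<exists>d\<in>D. \<forall>x\<in>G. cmod (q ((x \<circ> g) z) - q ((x \<circ> d) z)) \<le> cmod (q z) - t"
    using almost_periodic_net[OF almost_periodic_polynomial[OF q, of z], of "cmod (q z) - t"] t by auto
  have large: "\<exists>d\<in>D. t \<le> cmod (q (g (d z)))" if g: "g \<in> G" for g
  proof -
    \<comment> \<open>Approximating the inverse \<open>h\<close> of \<open>g\<close> by some
      \<open>d\<close> in \<open>D\<close> brings \<open>q (g (d z))\<close> close to
      \<open>q z\<close>.\<close>
    obtain h where h: "h \<in> G" "g \<circ> h = id"
      using r_inv_ex[of g] g by auto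
    obtain d where d: "d \<in> D" "\<forall>x\<in>G. cmod (q ((x \<circ> h) z) - q ((x \<circ> d) z)) \<le> cmod (q z) - t"
      using net[OF h(1)] by blast
    have "cmod (q ((g \<circ> h) z) - q ((g \<circ> d) z)) \<le> cmod (q z) - t" using d(2) g by blast
    then have "cmod (q z - q (g (d z))) \<le> cmod (q z) - t" using h(2) by simp
    then have "t \<le> cmod (q (g (d z)))" using norm_triangle_sub[of "q z" "q (g (d z))"] by linarith
    with d(1) show ?thesis by blast
  qed
  define M where "M = real (card D)"
  have M: "M \<ge> 1" using D by (simp add: M_def Suc_leI card_gt_0_iff)
  have t0: "t > 0" using r by linarith
  have "\<forall>\<^sub>F k in sequentially. M * ((r / t) ^ k + (s / t) ^ k) < 1 / 2"
  proof (rule order_tendstoD(2))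
    show "(\<lambda>k. M * ((r / t) ^ k + (s / t) ^ k)) \<longlonglongrightarrow> M * (0 + 0)"
      using r s t0 by (intro tendsto_intros LIMSEQ_realpow_zero) auto
  qed simp
  then obtain k0 where k0: "\<And>k. k \<ge> k0 \<Longrightarrow> M * ((r / t) ^ k + (s / t) ^ k) < 1 / 2"
    by (auto simp: eventually_sequentially)
  let ?A = "{Arg2pi (q (g z)) | g. r \<le> cmod (q (g z)) \<and> g \<in> G}"
  obtain k where k: "k \<ge> k0" "\<forall>u\<in>cis ` ?A. Re (u ^ k) \<ge> 1 / 2"
  proof -
    have "finite (cis ` ?A)" using args by (rule finite_imageI)
    moreover have "cmod u = 1" if "u \<in> cis ` ?A" for u using that by auto
    ultimately show ?thesis using powers_near_one[of "cis ` ?A" k0] that by blast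
  qed
  \<comment> \<open>In a sum over \<open>D\<close> one term has real part at least
    \<open>t ^ k / 2\<close> and each other at least \<open>- (r ^ k)\<close>; the total has to
    exceed \<open>M * s ^ k\<close>, which dictates the choice of \<open>k0\<close>.\<close>
  have tk: "M * (r ^ k + s ^ k) < t ^ k / 2"
  proof -
    have "M * ((r / t) ^ k + (s / t) ^ k) = M * (r ^ k + s ^ k) / t ^ k"
      by (simp add: power_divide flip: add_divide_distrib)
    then show ?thesis using k0[OF k(1)] t0 by (simp add: divide_less_eq)
  qed
  have half: "Re (q (g z) ^ k) \<ge> cmod (q (g z)) ^ k / 2" if "g \<in> G" "r \<le> cmod (q (g z))" for g
    by (rule Re_power_Arg2pi) (use k(2) that in blast)
  have lower: "Re (q (g z) ^ k) \<ge> - (r ^ k)" if g: "g \<in> G" for g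
  proof (cases "r \<le> cmod (q (g z))")
    case True
    have "- (r ^ k) \<le> 0" "0 \<le> cmod (q (g z)) ^ k / 2" using r by auto
    then show ?thesis using half[OF g True] by linarith
  next
    case False
    then have "cmod (q (g z)) ^ k \<le> r ^ k" by (intro power_mono) auto
    then show ?thesis using abs_Re_le_cmod[of "q (g z) ^ k"] by (simp add: norm_power)
  qed
  have "(\<lambda>x. q x ^ k) \<in> fun_span (coord_monomials e n (S k))"
    by (rule fun_span_monomials_power[OF q S(2,3)])
  from polynomial_average[OF this S(1)] obtain P where
    P: "P \<in> fun_span (coord_monomials e n (S k))" "invariant_fun G P" and
    avg: "\<And>D C x. \<lbrakk>finite D; D \<subseteq> G; closed C; convex C; \<forall>g\<in>G. (\<Sum>d\<in>D. q (g (d x)) ^ k) \<in> C\<rbrakk>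
      \<Longrightarrow> of_nat (card D) * P x \<in> C" by blast
  have "cmod (P w) \<le> s ^ k" if w: "w \<in> K" for w
  proof -
    have "\<forall>g\<in>G. (\<Sum>d\<in>{id}. q (g (d w)) ^ k) \<in> cball 0 (s ^ k)"
      using K[OF w] by (auto simp: norm_power intro: power_mono)
    from avg[OF _ _ _ _ this] id show ?thesis by simp
  qed
  moreover have "s ^ k < cmod (P z)"
  proof -
    have "\<forall>g\<in>G. (\<Sum>d\<in>D. q (g (d z)) ^ k) \<in> {w. Re w \<ge> t ^ k / 2 - M * r ^ k}"
    proof
      fix g assume g: "g \<in> G"
      have gd: "g \<circ> d \<in> G" if "d \<in> D" for d using m_closed[of g d] g that D by auto
      obtain d where d: "d \<in> D" "t \<le> cmod (q (g (d z)))" using large[OF g] by blast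
      have "t ^ k \<le> cmod (q (g (d z))) ^ k" using d t0 by (intro power_mono) auto
      then have 1: "Re (q (g (d z)) ^ k) \<ge> t ^ k / 2"
        using half[OF gd[OF d(1)]] d(2) r by auto
      have "(\<Sum>d\<in>D - {d}. - (r ^ k)) \<le> (\<Sum>d\<in>D - {d}. Re (q (g (d z)) ^ k))"
        by (intro sum_mono) (use lower[OF gd] in auto)
      moreover have "(\<Sum>d\<in>D - {d}. - (r ^ k)) = - ((M - 1) * r ^ k)"
        using D d by (simp add: M_def of_nat_diff Suc_leI card_gt_0_iff)
      moreover have "(\<Sum>d\<in>D. Re (q (g (d z)) ^ k)) = Re (q (g (d z)) ^ k) + (\<Sum>d\<in>D - {d}. Re (q (g (d z)) ^ k))"
        by (rule sum.remove) (use D d in auto)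
      moreover have "0 \<le> r ^ k" using r by simp
      ultimately have "t ^ k / 2 - M * r ^ k \<le> (\<Sum>d\<in>D. Re (q (g (d z)) ^ k))"
        using 1 by (simp add: algebra_simps)
      then show "(\<Sum>d\<in>D. q (g (d z)) ^ k) \<in> {w. Re w \<ge> t ^ k / 2 - M * r ^ k}" by simp
    qed
    from avg[OF D(1,2) closed_halfspace_Re_ge convex_halfspace_Re_ge this]
    have "t ^ k / 2 - M * r ^ k \<le> M * Re (P z)" by (simp add: M_def)
    also have "\<dots> \<le> M * cmod (P z)" using M by (intro mult_left_mono complex_Re_le_cmod) auto
    finally have "M * s ^ k < M * cmod (P z)" using tk by (simp add: algebra_simps)
    then show ?thesis using M by simp
  qed
  ultimately show ?thesis using P by blast
qed

end
end

theorem theorem3p8: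
  fixes e :: "nat \<Rightarrow> 'a::complex_banach"
    and G :: "('a \<Rightarrow> 'a) set" and \<tau> :: "('a \<Rightarrow> 'a) topology"
    and K :: "'a set" and j :: "nat \<Rightarrow> nat"
    and z :: 'a and Q :: "'a \<Rightarrow> complex" and r :: real
  assumes "schauder_basis e"
    and "topological_operator_group G \<tau>"
    and "acts_separately_continuously G \<tau>"
    and "invariant_set G K"
    and "strict_mono j" and "\<And>n. 1 \<le> j n"
    and "\<And>n. LCn_compact_subgroup (j n) (compressions e G (j n))"
    and "\<And>n g. g \<in> G \<Longrightarrow>
      g ` module.span (*\<^sub>C) {e i | i. j n \<le> i} \<subseteq> module.span (*\<^sub>C) {e i | i. j n \<le> i}"
    and "\<And>n. basis_proj e (j n) ` K \<subseteq> K"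
    and "z \<notin> K"
    and "continuous_polynomial Q" and "separates Q z K"
    and "0 < r" and "r < 1" and "r < cmod (Q z)"
    and "\<And>n. finite {Arg2pi ((Q \<circ> basis_embed e (j n)) (\<gamma> (coord_map e (j n) z))) | \<gamma>.
      r \<le> cmod ((Q \<circ> basis_embed e (j n)) (\<gamma> (coord_map e (j n) z))) \<and>
      \<gamma> \<in> compressions e G (j n)}"
  shows "(\<exists>P. continuous_polynomial P \<and> invariant_fun G P \<and> separates P z K) \<and>
    (homogeneous_polynomial Q \<longrightarrow>
      (\<exists>P. continuous_polynomial P \<and> homogeneous_polynomial P \<and> invariant_fun G P \<and> separates P z K))"
proof -
  have grp: "group (comp_monoid G)" and ops: "G \<subseteq> operators"
    using assms(2) by (auto simp: topological_operator_group_def)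
  have contQ: "continuous_on UNIV Q" using assms(11) by (simp add: continuous_polynomial_def)
  obtain s where s: "0 \<le> s" "s < cmod (Q z)" "\<And>w. w \<in> K \<Longrightarrow> cmod (Q w) \<le> s"
  proof -
    obtain s' where s': "(SUP w\<in>K. ereal (cmod (Q w))) < ereal s'" "ereal s' < ereal (cmod (Q z))"
      using assms(12) ereal_dense2 unfolding separates_def by blast
    \<comment> \<open>For empty \<open>K\<close> the supremum is minus infinity and
      \<open>s'\<close> may be negative, hence the maximum with 0.\<close>
    have "cmod (Q w) \<le> max 0 s'" if "w \<in> K" for w
    proof -
      have "ereal (cmod (Q w)) \<le> (SUP w\<in>K. ereal (cmod (Q w)))" by (rule SUP_upper[OF that])
      then have "ereal (cmod (Q w)) < ereal s'" using s'(1) by (rule le_less_trans)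
      then show ?thesis by simp
    qed
    moreover have "max 0 s' < cmod (Q z)" using s'(2) less_trans[OF assms(13,15)] by simp
    ultimately show ?thesis using that[of "max 0 s'"] by simp
  qed
  have "max s r < cmod (Q z)" using s assms(15) by simp
  \<comment> \<open>The gap above \<open>t\<close> allows \<open>Q z\<close> to be replaced by the
    value at a projection of \<open>z\<close>; what then remains of it is the error allowed for the
    net of group elements.\<close>
  then obtain t where t: "s < t" "r < t" "t < cmod (Q z)" using dense[of "max s r" "cmod (Q z)"] by auto
  have "(\<lambda>n. basis_proj e (j n) z) \<longlonglongrightarrow> z"
    using LIMSEQ_subseq_LIMSEQ[OF basis_proj_tendsto[OF assms(1), of z] assms(5)] by (simp add: o_def)
  then have "(\<lambda>n. cmod (Q (basis_proj e (j n) z))) \<longlonglongrightarrow> cmod (Q z)"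
    using contQ by (auto simp: continuous_on_eq_continuous_at intro!: tendsto_norm isCont_tendsto_compose[of _ Q])
  from order_tendstoD(1)[OF this t(3)]
  obtain n0 where n0: "t < cmod (Q (basis_proj e (j n0) z))" by (auto simp: eventually_sequentially)
  define n where "n = j n0"
  define q where "q = (\<lambda>x. Q (basis_proj e n x))"
  have tz: "t < cmod (q z)" using n0 by (simp add: q_def n_def)
  have comp: "compactin (LCn_topology n) (compressions e G n)"
    using assms(7)[of n0] by (simp add: n_def LCn_compact_subgroup_def)
  note tail = assms(8)[of _ n0, folded n_def]
  have qK: "cmod (q (g w)) \<le> s" if "w \<in> K" "g \<in> G" for w g
    using that assms(4) assms(9)[of n0] s(3) by (force simp: q_def n_def invariant_set_def)
  \<comment> \<open>Since \<open>g\<close> preserves the tail span, projecting \<open>z\<close>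
    before applying \<open>g\<close> does not change the first \<open>n\<close> coordinates of the
    result. The values of the compressed action are thus the values of \<open>q\<close> on the orbit
    of \<open>z\<close>.\<close>
  have "{Arg2pi (q (g z)) | g. r \<le> cmod (q (g z)) \<and> g \<in> G}
      \<subseteq> {Arg2pi ((Q \<circ> basis_embed e n) (\<gamma> (coord_map e n z))) | \<gamma>.
      r \<le> cmod ((Q \<circ> basis_embed e n) (\<gamma> (coord_map e n z))) \<and> \<gamma> \<in> compressions e G n}"
  proof clarify
    fix g assume g: "g \<in> G" and rg: "r \<le> cmod (q (g z))"
    have "coords e (g x) i = (\<Sum>k<n. coords e (g (e k)) i * coords e x k)" if "i < n" for x i
      by (rule coords_group[OF assms(1) grp ops comp tail g that])
    then have "coords e (g (basis_proj e n z)) i = coords e (g z) i" if "i < n" for i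
      using that by (simp add: coords_basis_proj[OF assms(1)])
    then have "basis_proj e n (g (basis_proj e n z)) = basis_proj e n (g z)"
      by (simp add: basis_proj_def)
    then have eq: "(Q \<circ> basis_embed e n) ((coord_map e n \<circ> g \<circ> basis_embed e n) (coord_map e n z)) = q (g z)"
      by (simp add: basis_embed_coord_map[OF assms(1)] q_def)
    show "\<exists>\<gamma>. Arg2pi (q (g z)) = Arg2pi ((Q \<circ> basis_embed e n) (\<gamma> (coord_map e n z))) \<and>
        r \<le> cmod ((Q \<circ> basis_embed e n) (\<gamma> (coord_map e n z))) \<and> \<gamma> \<in> compressions e G n"
      using g rg eq by (intro exI[of _ "coord_map e n \<circ> g \<circ> basis_embed e n"]) (auto simp: compressions_def)
  qed
  then have args: "finite {Arg2pi (q (g z)) | g. r \<le> cmod (q (g z)) \<and> g \<in> G}"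
    by (rule finite_subset) (use assms(16)[of n0] in \<open>simp add: n_def\<close>)
  have avg: "\<exists>k. \<exists>P\<in>fun_span (coord_monomials e n (S k)). invariant_fun G P \<and> separates P z K"
    if S: "q \<in> fun_span (coord_monomials e n (S 1))" "\<And>k. finite (S k)" "0 \<in> S 0"
      "\<And>k a b. a \<in> S 1 \<Longrightarrow> b \<in> S k \<Longrightarrow> a + b \<in> S (Suc k)" for S
  proof -
    have "\<exists>k. \<exists>P\<in>fun_span (coord_monomials e n (S k)). invariant_fun G P \<and>
        (\<forall>w\<in>K. cmod (P w) \<le> s ^ k) \<and> s ^ k < cmod (P z)"
      by (rule separating_average[OF assms(1) grp ops comp tail, where q = q and r = r and t = t])
        (assumption | fact S s(1) t(1,2) assms(13) tz qK args)+
    then obtain k P where P: "P \<in> fun_span (coord_monomials e n (S k))" "invariant_fun G P"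
      "\<forall>w\<in>K. cmod (P w) \<le> s ^ k" "s ^ k < cmod (P z)"
      by blast
    have "(SUP w\<in>K. ereal (cmod (P w))) \<le> ereal (s ^ k)" by (rule SUP_least) (use P in simp)
    also have "\<dots> < ereal (cmod (P z))" using P by simp
    finally show ?thesis using P by (auto simp: separates_def)
  qed
  show ?thesis
  proof (intro conjI impI)
    obtain N where N: "q \<in> fun_span (coord_monomials e n {..N})"
      unfolding q_def by (rule continuous_polynomial_basis_proj[OF assms(11)])
    obtain k P where "P \<in> fun_span (coord_monomials e n {..N * k})" "invariant_fun G P" "separates P z K"
      using avg[of "\<lambda>k. {..N * k}"] N by auto
    then show "\<exists>P. continuous_polynomial P \<and> invariant_fun G P \<and> separates P z K"
      using fun_span_monomials_polynomial[OF assms(1)] by blast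
  next
    assume "homogeneous_polynomial Q"
    then obtain m where "homogeneous_polynomial_of_degree m Q" by (auto simp: homogeneous_polynomial_def)
    then have "q \<in> fun_span (coord_monomials e n {m})"
      unfolding q_def by (rule homogeneous_polynomial_basis_proj)
    then obtain k P where P: "P \<in> fun_span (coord_monomials e n {m * k})" "invariant_fun G P" "separates P z K"
      using avg[of "\<lambda>k. {m * k}"] by auto
    then show "\<exists>P. continuous_polynomial P \<and> homogeneous_polynomial P \<and> invariant_fun G P \<and> separates P z K"
      using fun_span_monomials_homogeneous[OF assms(1) P(1)]
        fun_span_monomials_polynomial[OF assms(1) fun_span_monomials_mono[OF P(1), of "{..m * k}"]]
      by (auto simp: homogeneous_polynomial_def)
  qed
qed

end
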